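(* Let $M$ be an oriented time-like surface in $\mathbb L^3_1(c)\,{}_f\times I$ such that $T=\left(\frac{\partial}{\partial z}\right)^T$ is light-like on $M$, and consider the positively oriented global frame field $\{T,U;e_3,e_4\}$ determined by $\frac{\partial}{\partial z}\big|_M=T+e_3$. Let $h^a_{jk}$ ($a=3,4$; $j,k=1,2$) be the smooth functions with $h(T,T)=h^3_{11}e_3+h^4_{11}e_4$, $h(T,U)=h^3_{12}e_3+h^4_{12}e_4$, $h(U,U)=h^3_{22}e_3+h^4_{22}e_4$. Then (with $f,f'$ evaluated at the $z$-coordinate): (1) The Levi-Civita connection $\nabla$ of $M$ satisfies $$\nabla_TT=\nabla_TU=0,\quad \nabla_UT=\left(\frac{f'}f-h^3_{22}\right)T,\quad \nabla_UU=-\left(\frac{f'}f-h^3_{22}\right)U.$$ (2) The matrix representations of the shape operators with respect to $\{T,U\}$ are $$A_{e_3}=\begin{pmatrix}-\frac{f'}f&-h^3_{22}\\0&-\frac{f'}f\end{pmatrix},\qquad A_{e_4}=\begin{pmatrix}-h^4_{12}&-h^4_{22}\\-h^4_{11}&-h^4_{12}\end{pmatrix}.$$ (3) The second fundamental form satisfies $$h(T,T)=h^4_{11}e_4,\quad h(T,U)=\frac{f'}fe_3+h^4_{12}e_4,\quad h(U,U)=h^3_{22}e_3+h^4_{22}e_4.$$ (4) The normal connection satisfies $$\nabla^\perp_Te_3=-h^4_{11}e_4,\qquad \nabla^\perp_Ue_3=-h^4_{12}e_4.$$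
   Context: Let $c\in\{-1,0,1\}$. $\mathbb L^3_1(c)$ denotes the 3-dimensional Lorentzian space form with metric $g_c$ of constant curvature $c$ (de Sitter space $\mathbb S^3_1$ for $c=1$, Minkowski space $\mathbb E^3_1$ for $c=0$, anti-de Sitter space $\mathbb H^3_1$ for $c=-1$). Let $I$ be an open interval with coordinate $z$, $f:I\to(0,\infty)$ smooth, and let $\mathbb L^3_1(c)\,{}_f\times I$ be $\mathbb L^3_1(c)\times I$ with the metric $\widetilde g=\langle\cdot,\cdot\rangle=f(z)^2g_c+dz^2$. For a time-like surface $M$ (induced metric Lorentzian), write $\frac{\partial}{\partial z}\big|_M=T+\eta$ with $T=\left(\frac{\partial}{\partial z}\right)^T$ tangent and $\eta$ normal to $M$. $T$ is light-like if $T\ne0$ and $\langle T,T\rangle=0$ at every point. Standing assumptions: $T$ and $\eta$ vanish nowhere, and no open subset of $M$ lies in a totally geodesic hypersurface. When $T$ is light-like, $\eta=:e_3$ is a unit normal field; $U$ is the tangent field with $\langle U,U\rangle=0$, $\langle T,U\rangle=-1$, and $e_4$ is the unit normal field orthogonal to $e_3$ making the frame positively oriented. Conventions: $\widetilde\nabla_XY=\nabla_XY+h(X,Y)$, $\widetilde\nabla_X\xi=-A_\xi X+\nabla^\perp_X\xi$, $\langle h(X,Y),\xi\rangle=\langle A_\xi X,Y\rangle$; the columns of the matrix of $A_\xi$ are the coordinates of $A_\xi T$ and $A_\xi U$ in $\{T,U\}$. *)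

theory Defs
  imports "HOL-Analysis.Analysis"
begin

section \<open>Smooth maps on open subsets of Euclidean spaces\<close>

primrec Ck_on :: "nat \<Rightarrow> 'a::euclidean_space set \<Rightarrow> ('a \<Rightarrow> 'b::real_normed_vector) \<Rightarrow> bool" where
  "Ck_on 0 S h \<longleftrightarrow> continuous_on S h"
| "Ck_on (Suc k) S h \<longleftrightarrow> (\<forall>x\<in>S. h differentiable (at x)) \<and>
     (\<forall>v. Ck_on k S (\<lambda>x. frechet_derivative h (at x) v))"

text \<open>Only meant for open \<open>S\<close>.\<close>
definition smooth_on :: "'a::euclidean_space set \<Rightarrow> ('a \<Rightarrow> 'b::real_normed_vector) \<Rightarrow> bool" where
  "smooth_on S h \<longleftrightarrow> (\<forall>k. Ck_on k S h)"

section \<open>Levi-Civita connections via the Koszul formula\<close>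

text \<open>
  Tangent vectors of a manifold (or immersed manifold) sitting in a vector space \<open>'v\<close> are
  represented by their images in \<open>'v\<close>, and vector fields by \<open>'v\<close>-valued functions on the points
  \<open>'p\<close>. The argument \<open>D h p v\<close> is the derivative of the function \<open>h\<close> at \<open>p\<close> in direction \<open>v\<close>,
  \<open>br\<close> is the Lie bracket and \<open>G\<close> the metric.
\<close>

definition koszul ::
  "(('p \<Rightarrow> real) \<Rightarrow> 'p \<Rightarrow> 'v \<Rightarrow> real) \<Rightarrow> (('p \<Rightarrow> 'v) \<Rightarrow> ('p \<Rightarrow> 'v) \<Rightarrow> 'p \<Rightarrow> 'v) \<Rightarrow>
   ('p \<Rightarrow> 'v \<Rightarrow> 'v \<Rightarrow> real) \<Rightarrow> ('p \<Rightarrow> 'v) \<Rightarrow> ('p \<Rightarrow> 'v) \<Rightarrow> ('p \<Rightarrow> 'v) \<Rightarrow> 'p \<Rightarrow> real" where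
  "koszul D br G X Y Z p =
     D (\<lambda>r. G r (Y r) (Z r)) p (X p) + D (\<lambda>r. G r (X r) (Z r)) p (Y p) - D (\<lambda>r. G r (X r) (Y r)) p (Z p)
     + G p (br X Y p) (Z p) - G p (br X Z p) (Y p) - G p (br Y Z p) (X p)"

text \<open>
  The covariant derivative of the vector field \<open>Y\<close> at \<open>p\<close> in direction of the tangent vector \<open>v\<close>;
  \<open>fld p\<close> is the set of smooth tangent vector fields defined near \<open>p\<close>.
\<close>
definition levi_civita ::
  "(('p \<Rightarrow> real) \<Rightarrow> 'p \<Rightarrow> 'v \<Rightarrow> real) \<Rightarrow> (('p \<Rightarrow> 'v) \<Rightarrow> ('p \<Rightarrow> 'v) \<Rightarrow> 'p \<Rightarrow> 'v) \<Rightarrow>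
   ('p \<Rightarrow> 'v \<Rightarrow> 'v \<Rightarrow> real) \<Rightarrow> ('p \<Rightarrow> 'v set) \<Rightarrow> ('p \<Rightarrow> ('p \<Rightarrow> 'v) set) \<Rightarrow>
   'v \<Rightarrow> ('p \<Rightarrow> 'v) \<Rightarrow> 'p \<Rightarrow> 'v" where
  "levi_civita D br G Tan fld v Y p =
     (THE w. w \<in> Tan p \<and>
        (\<forall>X\<in>fld p. \<forall>Z\<in>fld p. X p = v \<longrightarrow> 2 * G p w (Z p) = koszul D br G X Y Z p))"

section \<open>The warped product of a Lorentzian space form and an interval\<close>

text \<open>
  The flat form on \<open>\<real>\<^sup>4\<close> has signature \<open>(-,+,+,+)\<close> for \<open>c \<ge> 0\<close> and \<open>(-,+,+,-)\<close> for \<open>c < 0\<close>.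
  De Sitter and anti-de Sitter space are the hyperquadrics \<open>\<langle>x,x\<rangle> = c\<close>; Minkowski space is the
  hyperplane of vectors with vanishing last coordinate.
\<close>

definition flat_form :: "real \<Rightarrow> real^4 \<Rightarrow> real^4 \<Rightarrow> real" where
  "flat_form c v w = - v$1 * w$1 + v$2 * w$2 + v$3 * w$3 + (if c < 0 then -1 else 1) * (v$4 * w$4)"

definition space_form :: "real \<Rightarrow> (real^4) set" where
  "space_form c = {x. if c = 0 then x$4 = 0 else flat_form c x x = c}"

definition space_form_tangent :: "real \<Rightarrow> real^4 \<Rightarrow> (real^4) set" where
  "space_form_tangent c x = {v. if c = 0 then v$4 = 0 else flat_form c x v = 0}"

type_synonym ambient = "(real^4) \<times> real"

definition warped :: "real \<Rightarrow> real set \<Rightarrow> ambient set" where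
  "warped c I = space_form c \<times> I"

definition warped_tangent :: "real \<Rightarrow> ambient \<Rightarrow> ambient set" where
  "warped_tangent c q = space_form_tangent c (fst q) \<times> UNIV"

definition warped_metric :: "real \<Rightarrow> (real \<Rightarrow> real) \<Rightarrow> ambient \<Rightarrow> ambient \<Rightarrow> ambient \<Rightarrow> real" where
  "warped_metric c f q v w = (f (snd q))\<^sup>2 * flat_form c (fst v) (fst w) + snd v * snd w"

definition d_dz :: ambient where
  "d_dz = (0, 1)"

text \<open>
  A smooth vector field on the warped product near \<open>q\<close> is given by a smooth extension to an open
  set of \<open>\<real>\<^sup>4 \<times> \<real>\<close>; the values off the warped product are irrelevant below because only
  derivatives in tangential directions are taken.
\<close>
definition warped_fields :: "real \<Rightarrow> real set \<Rightarrow> ambient \<Rightarrow> (ambient \<Rightarrow> ambient) set" where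
  "warped_fields c I q = {X. \<exists>W. open W \<and> q \<in> W \<and> smooth_on W X \<and>
      (\<forall>r\<in>W \<inter> warped c I. X r \<in> warped_tangent c r)}"

definition ambient_bracket :: "(ambient \<Rightarrow> ambient) \<Rightarrow> (ambient \<Rightarrow> ambient) \<Rightarrow> ambient \<Rightarrow> ambient" where
  "ambient_bracket X Y q = frechet_derivative Y (at q) (X q) - frechet_derivative X (at q) (Y q)"

definition warped_nabla ::
  "real \<Rightarrow> real set \<Rightarrow> (real \<Rightarrow> real) \<Rightarrow> ambient \<Rightarrow> (ambient \<Rightarrow> ambient) \<Rightarrow> ambient \<Rightarrow> ambient" where
  "warped_nabla c I f =
     levi_civita (\<lambda>h q. frechet_derivative h (at q)) ambient_bracket (warped_metric c f)
       (warped_tangent c) (warped_fields c I)"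

text \<open>
  The warped product is connected, so it has exactly two orientations; they are obtained for
  \<open>s = 1\<close> and \<open>s = -1\<close> from the transversal field of position vectors (for \<open>c = 0\<close>: from the
  fourth coordinate direction).
\<close>

definition to_real5 :: "ambient \<Rightarrow> real^5" where
  "to_real5 q = vector [fst q $ 1, fst q $ 2, fst q $ 3, fst q $ 4, snd q]"

definition positive_frame ::
  "real \<Rightarrow> real \<Rightarrow> ambient \<Rightarrow> ambient \<Rightarrow> ambient \<Rightarrow> ambient \<Rightarrow> ambient \<Rightarrow> bool" where
  "positive_frame c s q v1 v2 v3 v4 \<longleftrightarrow>
     s * det (vector [to_real5 (if c = 0 then axis 4 1 else fst q, 0),
       to_real5 v1, to_real5 v2, to_real5 v3, to_real5 v4] :: real^5^5) > 0"

section \<open>Totally geodesic hypersurfaces of the warped product\<close>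

definition hypersurface :: "real \<Rightarrow> real set \<Rightarrow> ambient set \<Rightarrow> bool" where
  "hypersurface c I P \<longleftrightarrow> P \<subseteq> warped c I \<and>
     (\<forall>q\<in>P. \<exists>W (\<rho> :: ambient \<Rightarrow> real). open W \<and> q \<in> W \<and> smooth_on W \<rho> \<and>
        P \<inter> W = {r \<in> warped c I \<inter> W. \<rho> r = 0} \<and>
        (\<forall>r\<in>P \<inter> W. \<exists>v\<in>warped_tangent c r. frechet_derivative \<rho> (at r) v \<noteq> 0))"

definition velocities :: "ambient set \<Rightarrow> ambient \<Rightarrow> ambient set" where
  "velocities P q = {v. \<exists>\<gamma> e. 0 < e \<and> smooth_on {-e<..<e} \<gamma> \<and> (\<forall>t\<in>{-e<..<e}. \<gamma> t \<in> P) \<and>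
      \<gamma> (0::real) = q \<and> (\<gamma> has_vector_derivative v) (at 0)}"

text \<open>
  As usual in semi-Riemannian geometry, the induced metric of the hypersurface is required to be
  non-degenerate.
\<close>
definition totally_geodesic_hypersurface ::
  "real \<Rightarrow> real set \<Rightarrow> (real \<Rightarrow> real) \<Rightarrow> ambient set \<Rightarrow> bool" where
  "totally_geodesic_hypersurface c I f P \<longleftrightarrow> hypersurface c I P \<and>
     (\<forall>q\<in>P. \<forall>v\<in>velocities P q. (\<forall>w\<in>velocities P q. warped_metric c f q v w = 0) \<longrightarrow> v = 0) \<and>
     (\<forall>q\<in>P. \<forall>v\<in>velocities P q. \<forall>Y\<in>warped_fields c I q.
        (\<exists>W. open W \<and> q \<in> W \<and> (\<forall>r\<in>P \<inter> W. Y r \<in> velocities P r)) \<longrightarrow>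
        warped_nabla c I f v Y q \<in> velocities P q)"

section \<open>Immersed surfaces\<close>

text \<open>
  A surface consists of a topological space, an atlas of charts \<open>(U, \<phi>)\<close> with domain \<open>U\<close>, and an
  immersion into \<open>\<real>\<^sup>4 \<times> \<real>\<close>.
\<close>
record 'm surface =
  topo :: "'m topology"
  charts :: "('m set \<times> ('m \<Rightarrow> real^2)) set"
  imm :: "'m \<Rightarrow> ambient"

abbreviation pts :: "'m surface \<Rightarrow> 'm set" where
  "pts S \<equiv> topspace (topo S)"

definition smooth_2_manifold :: "'m surface \<Rightarrow> bool" where
  "smooth_2_manifold S \<longleftrightarrow>
     Hausdorff_space (topo S) \<and> second_countable (topo S) \<and>
     \<Union> (fst ` charts S) = pts S \<and>
     (\<forall>(U,\<phi>)\<in>charts S. openin (topo S) U \<and> open (\<phi> ` U) \<and>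
        homeomorphic_map (subtopology (topo S) U) (top_of_set (\<phi> ` U)) \<phi>) \<and>
     (\<forall>(U,\<phi>)\<in>charts S. \<forall>(V,\<psi>)\<in>charts S. smooth_on (\<phi> ` (U \<inter> V)) (\<psi> \<circ> inv_into U \<phi>))"

definition oriented_charts :: "'m surface \<Rightarrow> bool" where
  "oriented_charts S \<longleftrightarrow>
     (\<forall>(U,\<phi>)\<in>charts S. \<forall>(V,\<psi>)\<in>charts S. \<forall>p\<in>U \<inter> V.
        det (matrix (frechet_derivative (\<psi> \<circ> inv_into U \<phi>) (at (\<phi> p)))) > 0)"

definition surface_smooth_on :: "'m surface \<Rightarrow> 'm set \<Rightarrow> ('m \<Rightarrow> 'b::real_normed_vector) \<Rightarrow> bool" where
  "surface_smooth_on S W h \<longleftrightarrow> (\<forall>(U,\<phi>)\<in>charts S. smooth_on (\<phi> ` (U \<inter> W)) (h \<circ> inv_into U \<phi>))"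

definition immersed_in_warped :: "real \<Rightarrow> real set \<Rightarrow> 'm surface \<Rightarrow> bool" where
  "immersed_in_warped c I S \<longleftrightarrow>
     surface_smooth_on S (pts S) (imm S) \<and> imm S ` pts S \<subseteq> warped c I \<and>
     (\<forall>(U,\<phi>)\<in>charts S. \<forall>p\<in>U. inj (frechet_derivative (imm S \<circ> inv_into U \<phi>) (at (\<phi> p))))"

text \<open>Tangent vectors of the surface are identified with their images under the differential of the
  immersion.\<close>
definition tangent_plane :: "'m surface \<Rightarrow> 'm \<Rightarrow> ambient set" where
  "tangent_plane S p = {v. \<exists>(U,\<phi>)\<in>charts S. p \<in> U \<and>
     v \<in> range (frechet_derivative (imm S \<circ> inv_into U \<phi>) (at (\<phi> p)))}"

definition surface_deriv ::
  "'m surface \<Rightarrow> ('m \<Rightarrow> 'b::real_normed_vector) \<Rightarrow> 'm \<Rightarrow> ambient \<Rightarrow> 'b" where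
  "surface_deriv S h p v = (THE d. \<exists>(U,\<phi>)\<in>charts S. p \<in> U \<and>
     (\<exists>a. v = frechet_derivative (imm S \<circ> inv_into U \<phi>) (at (\<phi> p)) a \<and>
          d = frechet_derivative (h \<circ> inv_into U \<phi>) (at (\<phi> p)) a))"

text \<open>A vector field \<open>X\<close> satisfies \<open>X = X(F)\<close> for the immersion \<open>F\<close>, so that the bracket
  \<open>[X,Y](F) = X(Y(F)) - Y(X(F))\<close> takes the following form.\<close>
definition surface_bracket ::
  "'m surface \<Rightarrow> ('m \<Rightarrow> ambient) \<Rightarrow> ('m \<Rightarrow> ambient) \<Rightarrow> 'm \<Rightarrow> ambient" where
  "surface_bracket S X Y p = surface_deriv S Y p (X p) - surface_deriv S X p (Y p)"

definition induced_metric ::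
  "real \<Rightarrow> (real \<Rightarrow> real) \<Rightarrow> 'm surface \<Rightarrow> 'm \<Rightarrow> ambient \<Rightarrow> ambient \<Rightarrow> real" where
  "induced_metric c f S p = warped_metric c f (imm S p)"

definition time_like :: "real \<Rightarrow> (real \<Rightarrow> real) \<Rightarrow> 'm surface \<Rightarrow> bool" where
  "time_like c f S \<longleftrightarrow> (\<forall>p\<in>pts S. \<exists>v\<in>tangent_plane S p. \<exists>w\<in>tangent_plane S p.
     induced_metric c f S p v v = -1 \<and> induced_metric c f S p w w = 1 \<and>
     induced_metric c f S p v w = 0)"

definition tangent_field :: "'m surface \<Rightarrow> 'm set \<Rightarrow> ('m \<Rightarrow> ambient) \<Rightarrow> bool" where
  "tangent_field S W X \<longleftrightarrow> surface_smooth_on S W X \<and> (\<forall>p\<in>W. X p \<in> tangent_plane S p)"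

definition normal_field ::
  "real \<Rightarrow> (real \<Rightarrow> real) \<Rightarrow> 'm surface \<Rightarrow> ('m \<Rightarrow> ambient) \<Rightarrow> bool" where
  "normal_field c f S \<xi> \<longleftrightarrow> surface_smooth_on S (pts S) \<xi> \<and>
     (\<forall>p\<in>pts S. \<xi> p \<in> warped_tangent c (imm S p) \<and>
        (\<forall>v\<in>tangent_plane S p. induced_metric c f S p (\<xi> p) v = 0))"

definition local_tangent_fields :: "'m surface \<Rightarrow> 'm \<Rightarrow> ('m \<Rightarrow> ambient) set" where
  "local_tangent_fields S p = {X. \<exists>W. openin (topo S) W \<and> p \<in> W \<and> tangent_field S W X}"

text \<open>The intrinsic Levi-Civita connection of the induced metric.\<close>
definition surface_nabla ::
  "real \<Rightarrow> (real \<Rightarrow> real) \<Rightarrow> 'm surface \<Rightarrow> ('m \<Rightarrow> ambient) \<Rightarrow> ('m \<Rightarrow> ambient) \<Rightarrow> 'm \<Rightarrow> ambient" where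
  "surface_nabla c f S X Y p =
     levi_civita (surface_deriv S) (surface_bracket S) (induced_metric c f S)
       (tangent_plane S) (local_tangent_fields S) (X p) Y p"

text \<open>
  The Levi-Civita connection of the warped product, acting on a vector field \<open>Y\<close> along the
  immersion \<open>F\<close> (the pull-back connection): if \<open>Y = \<Sum>i<n. y i *\<^sub>R (V i \<circ> F)\<close> near \<open>p\<close> for smooth
  functions \<open>y i\<close> and vector fields \<open>V i\<close> of the warped product, then the derivative in direction
  \<open>v\<close> is \<open>\<Sum>i<n. v(y i) *\<^sub>R V i + y i *\<^sub>R \<nabla>\<^sub>v V i\<close>.
\<close>
definition ambient_nabla ::
  "real \<Rightarrow> real set \<Rightarrow> (real \<Rightarrow> real) \<Rightarrow> 'm surface \<Rightarrow>
   ('m \<Rightarrow> ambient) \<Rightarrow> ('m \<Rightarrow> ambient) \<Rightarrow> 'm \<Rightarrow> ambient" where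
  "ambient_nabla c I f S X Y p =
     (THE w. \<exists>W (n::nat) (y :: nat \<Rightarrow> 'm \<Rightarrow> real) V.
        openin (topo S) W \<and> p \<in> W \<and>
        (\<forall>i<n. surface_smooth_on S W (y i) \<and> V i \<in> warped_fields c I (imm S p)) \<and>
        (\<forall>r\<in>W. Y r = (\<Sum>i<n. y i r *\<^sub>R V i (imm S r))) \<and>
        w = (\<Sum>i<n. surface_deriv S (y i) p (X p) *\<^sub>R V i (imm S p)
                  + y i p *\<^sub>R warped_nabla c I f (X p) (V i) (imm S p)))"

definition tangential_part ::
  "real \<Rightarrow> (real \<Rightarrow> real) \<Rightarrow> 'm surface \<Rightarrow> 'm \<Rightarrow> ambient \<Rightarrow> ambient" where
  "tangential_part c f S p w =
     (THE t. t \<in> tangent_plane S p \<and> (\<forall>u\<in>tangent_plane S p. induced_metric c f S p (w - t) u = 0))"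

text \<open>Gauss and Weingarten formulas.\<close>

definition second_fundamental_form ::
  "real \<Rightarrow> real set \<Rightarrow> (real \<Rightarrow> real) \<Rightarrow> 'm surface \<Rightarrow>
   ('m \<Rightarrow> ambient) \<Rightarrow> ('m \<Rightarrow> ambient) \<Rightarrow> 'm \<Rightarrow> ambient" where
  "second_fundamental_form c I f S X Y p = ambient_nabla c I f S X Y p - surface_nabla c f S X Y p"

definition shape_operator ::
  "real \<Rightarrow> real set \<Rightarrow> (real \<Rightarrow> real) \<Rightarrow> 'm surface \<Rightarrow>
   ('m \<Rightarrow> ambient) \<Rightarrow> ('m \<Rightarrow> ambient) \<Rightarrow> 'm \<Rightarrow> ambient" where
  "shape_operator c I f S \<xi> X p = - tangential_part c f S p (ambient_nabla c I f S X \<xi> p)"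

definition normal_nabla ::
  "real \<Rightarrow> real set \<Rightarrow> (real \<Rightarrow> real) \<Rightarrow> 'm surface \<Rightarrow>
   ('m \<Rightarrow> ambient) \<Rightarrow> ('m \<Rightarrow> ambient) \<Rightarrow> 'm \<Rightarrow> ambient" where
  "normal_nabla c I f S X \<xi> p =
     ambient_nabla c I f S X \<xi> p - tangential_part c f S p (ambient_nabla c I f S X \<xi> p)"

text \<open>The columns of \<open>A\<close> are the coordinates of the images \<open>w1\<close>, \<open>w2\<close> of \<open>b1\<close>, \<open>b2\<close> with respect
  to the basis \<open>b1\<close>, \<open>b2\<close>.\<close>
definition has_matrix ::
  "'v::real_vector \<Rightarrow> 'v \<Rightarrow> 'v \<Rightarrow> 'v \<Rightarrow> real^2^2 \<Rightarrow> bool" where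
  "has_matrix b1 b2 w1 w2 A \<longleftrightarrow>
     w1 = A$1$1 *\<^sub>R b1 + A$2$1 *\<^sub>R b2 \<and> w2 = A$1$2 *\<^sub>R b1 + A$2$2 *\<^sub>R b2"

end

theory Submission
  imports Defs
begin

text \<open>
  The vertical field \<open>d_dz\<close> of a warped product is closed and conformal: if \<open>D\<close> denotes the
  Levi-Civita connection of the warped product and \<open>k = f'/f\<close>, then
  \<open>D\<^sub>X d_dz = k (X - \<langle>X, d_dz\<rangle> d_dz)\<close>. Along the surface \<open>d_dz = T + e3\<close> with
  \<open>\<langle>T, d_dz\<rangle> = 0\<close> and \<open>\<langle>U, d_dz\<rangle> = -1\<close>, so that
  \<open>D\<^sub>T T + D\<^sub>T e3 = k T\<close> and \<open>D\<^sub>U T + D\<^sub>U e3 = k (U + T + e3)\<close> (lemma \<open>D_vertical\<close>).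
  All the inner products of members of the frame \<open>T, U, e3, e4\<close> are constant, hence
  \<open>\<langle>D\<^sub>X Y, Z\<rangle> = -\<langle>D\<^sub>X Z, Y\<rangle>\<close> for \<open>Y\<close>, \<open>Z\<close> in the frame (lemma \<open>D_skew\<close>), and the normal part of
  \<open>D\<^sub>X Y\<close> is symmetric in \<open>X\<close> and \<open>Y\<close>. Pairing the two equations with the members of
  the frame then determines every coefficient apart from those of \<open>h(U,U)\<close> and the \<open>e4\<close>-components.

  The main work is to see that the connections, which are defined through Koszul formulas and
  definite descriptions, are the expected ones. On the warped product the connection is
  \<open>D\<^sub>v Y = dY(v) + christoffel(v, Y)\<close>, where \<open>dY\<close> is the derivative in the flat space
  \<open>\<real>\<^sup>4 \<times> \<real>\<close> and the correction term is symmetric, bilinear and pointwise (proposition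
  \<open>warped_nabla_eq\<close>). Consequently the connection pulled back to the surface is
  given by the same formula with \<open>dY\<close> replaced by the derivative along the surface (proposition
  \<open>ambient_nabla_eq\<close>), and the intrinsic connection of the surface is its tangential projection
  (proposition \<open>surface_nabla_eq\<close>). In both cases one checks that the candidate is metric and
  torsion-free; these two properties give the Koszul formula by pure algebra (lemma
  \<open>koszul_metric_torsion_free\<close>), and non-degeneracy of the metric gives uniqueness.
\<close>

section \<open>Smooth maps and second derivatives\<close>

lemma smooth_on_differentiable: "smooth_on S h \<Longrightarrow> x \<in> S \<Longrightarrow> h differentiable (at x)"
  unfolding smooth_on_def by (metis Ck_on.simps(2))

lemma smooth_on_frechet_derivative:
  "smooth_on S h \<Longrightarrow> smooth_on S (\<lambda>x. frechet_derivative h (at x) v)"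
  unfolding smooth_on_def by (metis Ck_on.simps(2))

lemma Ck_on_cong:
  assumes "open S" "\<And>x. x \<in> S \<Longrightarrow> g x = h x" "Ck_on k S h"
  shows "Ck_on k S g"
  using assms(2,3)
proof (induction k arbitrary: g h)
  case 0
  then show ?case by (simp cong: continuous_on_cong)
next
  case (Suc k)
  have d: "(g has_derivative frechet_derivative h (at x)) (at x)" if "x \<in> S" for x
    using Suc.prems that
    by (metis Ck_on.simps(2) assms(1) frechet_derivative_works has_derivative_transform_within_open)
  have "frechet_derivative g (at x) = frechet_derivative h (at x)" if "x \<in> S" for x
    using d[OF that] by (metis frechet_derivative_at)
  then have "Ck_on k S (\<lambda>x. frechet_derivative g (at x) v)" for v
    using Suc.IH[of "\<lambda>x. frechet_derivative g (at x) v" "\<lambda>x. frechet_derivative h (at x) v"] Suc.prems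
    by simp
  moreover have "g differentiable (at x)" if "x \<in> S" for x
    using d[OF that] by (auto simp: differentiable_def)
  ultimately show ?case by simp
qed

lemma smooth_on_bounded_linear:
  assumes "open S" "bounded_linear L" "smooth_on S h"
  shows "smooth_on S (\<lambda>x. L (h x))"
proof -
  have "Ck_on k S (\<lambda>x. L (h x))" if "Ck_on k S h" for k and h :: "'a \<Rightarrow> 'b"
    using that
  proof (induction k arbitrary: h)
    case 0
    then show ?case
      using assms(2) by (simp add: bounded_linear.continuous_on)
  next
    case (Suc k)
    have d: "((\<lambda>x. L (h x)) has_derivative (\<lambda>v. L (frechet_derivative h (at x) v))) (at x)"
      if "x \<in> S" for x
      using Suc.prems that assms(2)
      by (simp add: bounded_linear.has_derivative flip: frechet_derivative_works)
    then have "frechet_derivative (\<lambda>x. L (h x)) (at x) v = L (frechet_derivative h (at x) v)"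
      if "x \<in> S" for x v
      using that by (metis frechet_derivative_at)
    then have "Ck_on k S (\<lambda>x. frechet_derivative (\<lambda>x. L (h x)) (at x) v)" for v
      by (rule Ck_on_cong[OF assms(1)]) (use Suc in auto)
    then show ?case using d by (auto simp: differentiable_def)
  qed
  then show ?thesis using assms(3) by (simp add: smooth_on_def)
qed

text \<open>
  The derivative of such a map in a fixed direction is affine, and the derivative of an affine map is
  constant. Tangent vectors of the warped product are extended to vector fields by maps of this form.
\<close>

lemma smooth_on_quadratic:
  fixes Q :: "'a::euclidean_space \<Rightarrow> 'a \<Rightarrow> 'b::real_normed_vector"
  assumes "bounded_bilinear Q"
  shows "smooth_on S (\<lambda>x. A + Q x x)"
proof -
  interpret bounded_bilinear Q by fact
  have affine: "Ck_on k S (\<lambda>x. B + L x)" if "bounded_linear L" for k and B :: 'b and L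
  proof (cases k)
    case 0
    then show ?thesis
      using linear_continuous_on[OF that, of S] by (simp add: continuous_on_add)
  next
    case (Suc l)
    have d: "((\<lambda>x. B + L x) has_derivative L) (at x)" for x
      using has_derivative_add[OF has_derivative_const bounded_linear_imp_has_derivative[OF that]]
      by simp
    have "Ck_on l S (\<lambda>x. C)" for l and C :: 'b
      by (induction l arbitrary: C) auto
    moreover have "frechet_derivative (\<lambda>x. B + L x) (at x) = L" for x
      using d by (metis frechet_derivative_at)
    ultimately show ?thesis
      using differentiableI[OF d] Suc by simp
  qed
  have "Ck_on k S (\<lambda>x. A + Q x x)" for k
  proof (cases k)
    case 0
    then show ?thesis
      using continuous_on[of S "\<lambda>x. x" "\<lambda>x. x"] by (simp add: continuous_on_add)
  next
    case (Suc l)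
    have d: "((\<lambda>x. A + Q x x) has_derivative (\<lambda>v. Q x v + Q v x)) (at x)" for x
      using has_derivative_add[OF has_derivative_const FDERIV[OF has_derivative_ident has_derivative_ident]]
      by simp
    then have "frechet_derivative (\<lambda>x. A + Q x x) (at x) = (\<lambda>v. Q x v + Q v x)" for x
      by (metis frechet_derivative_at)
    moreover have "Ck_on l S (\<lambda>x. 0 + (Q x v + Q v x))" for v
      by (rule affine) (intro bounded_linear_add bounded_linear_left bounded_linear_right)
    ultimately show ?thesis
      using differentiableI[OF d] Suc by simp
  qed
  then show ?thesis by (simp add: smooth_on_def)
qed

text \<open>
  The mean value theorem for \<open>s \<mapsto> g (P + s a + t b) - g (P + s a)\<close> on \<open>[0, t]\<close> expresses the
  second difference as \<open>t\<close> times a difference of two values of \<open>x \<mapsto> g' x a\<close>; the differentiability of this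
  map at the single point \<open>P\<close> evaluates the latter up to \<open>o(t)\<close>.
\<close>

lemma second_difference_limit:
  fixes g :: "'a::real_normed_vector \<Rightarrow> real"
  assumes "open S" "P \<in> S"
    and g: "\<And>x. x \<in> S \<Longrightarrow> (g has_derivative g' x) (at x)"
    and L: "((\<lambda>x. g' x a) has_derivative L) (at P)"
  shows "((\<lambda>t. (g (P + t *\<^sub>R a + t *\<^sub>R b) - g (P + t *\<^sub>R a) - g (P + t *\<^sub>R b) + g P) / t\<^sup>2)
           \<longlongrightarrow> L b) (at_right 0)"
proof (rule tendstoI)
  fix e :: real assume "e > 0"
  \<comment> \<open>The points in question lie within \<open>t * N\<close> of \<open>P\<close>; the two error terms of size \<open>e' * t * N\<close> add up to half of \<open>e * t\<close>.\<close>
  define N where "N = norm a + norm b + 1"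
  have N: "N > 0" by (simp add: N_def add_nonneg_pos)
  define e' where "e' = e / (4 * N)"
  have e': "e' > 0" using \<open>e > 0\<close> N by (simp add: e'_def)
  interpret L: bounded_linear L using L by (rule has_derivative_bounded_linear)
  obtain d where d: "d > 0" "\<And>y. norm (y - P) < d \<Longrightarrow>
      norm (g' y a - g' P a - L (y - P)) \<le> e' * norm (y - P)"
    using L e' by (auto simp: has_derivative_at_alt)
  obtain d' where d': "d' > 0" "ball P d' \<subseteq> S"
    using assms(1,2) open_contains_ball by blast
  define \<delta> where "\<delta> = min d d' / N"
  have "\<delta> > 0" using d d' N by (simp add: \<delta>_def)
  have "\<bar>(g (P + t *\<^sub>R a + t *\<^sub>R b) - g (P + t *\<^sub>R a) - g (P + t *\<^sub>R b) + g P) / t\<^sup>2 - L b\<bar> < e"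
    if t: "0 < t" "t < \<delta>" for t
  proof -
    have small: "norm (x *\<^sub>R a + y *\<^sub>R b) \<le> t * N \<and> t * N < min d d'"
      if "\<bar>x\<bar> \<le> t" "\<bar>y\<bar> \<le> t" for x y
    proof
      have "norm (x *\<^sub>R a + y *\<^sub>R b) \<le> \<bar>x\<bar> * norm a + \<bar>y\<bar> * norm b"
        by (metis norm_scaleR norm_triangle_ineq)
      also have "\<dots> \<le> t * norm a + t * norm b"
        using that by (intro add_mono mult_right_mono) auto
      also have "\<dots> \<le> t * N" using t by (simp add: N_def algebra_simps)
      finally show "norm (x *\<^sub>R a + y *\<^sub>R b) \<le> t * N" .
      show "t * N < min d d'" using t N by (simp add: \<delta>_def pos_less_divide_eq)
    qed
    have inS: "P + x *\<^sub>R a + y *\<^sub>R b \<in> S" if "\<bar>x\<bar> \<le> t" "\<bar>y\<bar> \<le> t" for x y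
    proof -
      have "dist P (P + x *\<^sub>R a + y *\<^sub>R b) < d'"
        using small[OF that] by (subst dist_commute) (simp add: dist_norm add.assoc)
      then show ?thesis using d' by auto
    qed
    let ?u = "\<lambda>s. g (P + s *\<^sub>R a + t *\<^sub>R b) - g (P + s *\<^sub>R a + 0 *\<^sub>R b)"
    let ?u' = "\<lambda>s. g' (P + s *\<^sub>R a + t *\<^sub>R b) a - g' (P + s *\<^sub>R a + 0 *\<^sub>R b) a"
    have du: "(?u has_real_derivative ?u' s) (at s)" if "0 \<le> s" "s \<le> t" for s
    proof -
      have line: "((\<lambda>s. P + s *\<^sub>R a + y *\<^sub>R b) has_derivative (\<lambda>h. h *\<^sub>R a)) (at s)" for y
        by (auto intro!: derivative_eq_intros)
      have lin: "g' x (h *\<^sub>R a) = h * g' x a" if "x \<in> S" for x h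
        using linear_cmul[OF has_derivative_linear[OF g[OF that]]] by simp
      have "((\<lambda>s. g (P + s *\<^sub>R a + y *\<^sub>R b)) has_derivative
          (\<lambda>h. g' (P + s *\<^sub>R a + y *\<^sub>R b) (h *\<^sub>R a))) (at s)" if "\<bar>y\<bar> \<le> t" for y
        using has_derivative_compose[OF line g[OF inS[of s y]]] \<open>0 \<le> s\<close> \<open>s \<le> t\<close> that by simp
      moreover have "(\<lambda>h. g' (P + s *\<^sub>R a + y *\<^sub>R b) (h *\<^sub>R a)) = (*) (g' (P + s *\<^sub>R a + y *\<^sub>R b) a)"
        if "\<bar>y\<bar> \<le> t" for y
        using lin[OF inS[of s y]] \<open>0 \<le> s\<close> \<open>s \<le> t\<close> that by (simp add: fun_eq_iff)
      ultimately have "((\<lambda>s. g (P + s *\<^sub>R a + y *\<^sub>R b)) has_real_derivative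
          g' (P + s *\<^sub>R a + y *\<^sub>R b) a) (at s)" if "\<bar>y\<bar> \<le> t" for y
        using that by (simp add: has_field_derivative_def)
      from this[of t] this[of 0] t show ?thesis by (intro derivative_intros) auto
    qed
    obtain z where z: "0 < z" "z < t" "?u t - ?u 0 = t * ?u' z"
      using MVT2[of 0 t ?u ?u'] t du by auto
    let ?y = "P + z *\<^sub>R a + t *\<^sub>R b" and ?x = "P + z *\<^sub>R a + 0 *\<^sub>R b"
    have y: "norm (g' ?y a - g' P a - L (?y - P)) \<le> e' * (t * N)"
      using d(2)[of ?y] small[of z t] z t e' by (auto intro: order_trans simp: add.assoc)
    have x: "norm (g' ?x a - g' P a - L (?x - P)) \<le> e' * (t * N)"
      using d(2)[of ?x] small[of z 0] z t e' by (auto intro: order_trans)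
    have "L (?y - P) - L (?x - P) = t * L b"
      by (simp add: L.add L.scaleR add.assoc)
    then have u': "\<bar>?u' z - t * L b\<bar> \<le> 2 * (e' * (t * N))"
      using x y by (simp add: abs_le_iff)
    have "(?u t - ?u 0) / t\<^sup>2 - L b = (?u' z - t * L b) / t"
      unfolding z(3) using t by (simp add: diff_divide_distrib power2_eq_square)
    also have "\<bar>\<dots>\<bar> \<le> 2 * (e' * N)"
      using u' t by (simp add: field_simps)
    also have "\<dots> < e" using \<open>e > 0\<close> N by (simp add: e'_def)
    finally show ?thesis by (simp add: algebra_simps)
  qed
  then show "\<forall>\<^sub>F t in at_right 0. dist ((g (P + t *\<^sub>R a + t *\<^sub>R b) - g (P + t *\<^sub>R a)
      - g (P + t *\<^sub>R b) + g P) / t\<^sup>2) (L b) < e"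
    unfolding eventually_at_right_field dist_real_def using \<open>\<delta> > 0\<close> by blast
qed

text \<open>
  The second difference is symmetric in \<open>a\<close> and \<open>b\<close>, so its two limits agree.
\<close>

lemma symmetric_second_derivative_real:
  fixes g :: "'a::real_normed_vector \<Rightarrow> real"
  assumes "open S" "P \<in> S"
    and g: "\<And>x. x \<in> S \<Longrightarrow> (g has_derivative g' x) (at x)"
    and "((\<lambda>x. g' x a) has_derivative La) (at P)" "((\<lambda>x. g' x b) has_derivative Lb) (at P)"
  shows "La b = Lb a"
proof -
  have "((\<lambda>t. (g (P + t *\<^sub>R a + t *\<^sub>R b) - g (P + t *\<^sub>R a) - g (P + t *\<^sub>R b) + g P) / t\<^sup>2)
           \<longlongrightarrow> Lb a) (at_right 0)"
    using second_difference_limit[of S P g g' b Lb a] assms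
    by (simp add: algebra_simps)
  moreover note second_difference_limit[of S P g g' a La b, OF assms(1-4)]
  ultimately show ?thesis
    using tendsto_unique trivial_limit_at_right_real by blast
qed

lemma symmetric_second_derivative:
  fixes F :: "'a::euclidean_space \<Rightarrow> 'b::euclidean_space"
  assumes "open S" "P \<in> S" "smooth_on S F"
  shows "frechet_derivative (\<lambda>x. frechet_derivative F (at x) a) (at P) b =
         frechet_derivative (\<lambda>x. frechet_derivative F (at x) b) (at P) a"
proof (rule euclidean_eqI)
  fix i :: 'b assume "i \<in> Basis"
  have F: "(F has_derivative frechet_derivative F (at x)) (at x)" if "x \<in> S" for x
    using assms(3) that by (simp add: smooth_on_differentiable flip: frechet_derivative_works)
  have F2: "((\<lambda>x. frechet_derivative F (at x) v) has_derivative
      frechet_derivative (\<lambda>x. frechet_derivative F (at x) v) (at P)) (at P)" for v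
    using assms smooth_on_frechet_derivative smooth_on_differentiable
    by (metis frechet_derivative_works)
  show "frechet_derivative (\<lambda>x. frechet_derivative F (at x) a) (at P) b \<bullet> i =
        frechet_derivative (\<lambda>x. frechet_derivative F (at x) b) (at P) a \<bullet> i"
    by (rule symmetric_second_derivative_real[OF assms(1,2), of "\<lambda>x. F x \<bullet> i"
          "\<lambda>x v. frechet_derivative F (at x) v \<bullet> i"])
      (intro has_derivative_inner_left F F2; assumption)+
qed

section \<open>The Koszul formula\<close>

text \<open>
  The classical uniqueness computation for the Levi-Civita connection, at one point and for three
  fields: the metric property of the candidate \<open>n\<close> expands the derivatives, the absence of torsion
  expands the brackets, and everything except \<open>2 * G (n X Y) Z\<close> cancels. It serves for the
  warped product as well as for the surface.
\<close>

lemma koszul_metric_torsion_free: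
  assumes "D (\<lambda>r. G r (Y r) (Z r)) p (X p) = G p (n X Y) (Z p) + G p (Y p) (n X Z)"
    and "D (\<lambda>r. G r (X r) (Z r)) p (Y p) = G p (n Y X) (Z p) + G p (X p) (n Y Z)"
    and "D (\<lambda>r. G r (X r) (Y r)) p (Z p) = G p (n Z X) (Y p) + G p (X p) (n Z Y)"
    and "\<And>A B. {A, B} \<subseteq> {X, Y, Z} \<Longrightarrow> br A B p = n A B - n B A"
    and G: "\<And>u v w. G p (u - v) w = G p u w - G p v w" "\<And>u v. G p u v = G p v u"
  shows "koszul D br G X Y Z p = 2 * G p (n X Y) (Z p)"
  using assms(1-3) unfolding koszul_def
  by (simp add: assms(4) G(1) G(2)[of "X p"] G(2)[of "Y p"])

lemma levi_civita_eqI: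
  assumes "w \<in> Tan p"
    and "\<And>X Z. X \<in> fld p \<Longrightarrow> Z \<in> fld p \<Longrightarrow> X p = v \<Longrightarrow> 2 * G p w (Z p) = koszul D br G X Y Z p"
    and "X0 \<in> fld p" "X0 p = v"
    and "\<And>u. u \<in> Tan p \<Longrightarrow> (\<And>Z. Z \<in> fld p \<Longrightarrow> G p u (Z p) = G p w (Z p)) \<Longrightarrow> u = w"
  shows "levi_civita D br G Tan fld v Y p = w"
  unfolding levi_civita_def
proof (rule the_equality)
  show "w \<in> Tan p \<and> (\<forall>X\<in>fld p. \<forall>Z\<in>fld p. X p = v \<longrightarrow> 2 * G p w (Z p) = koszul D br G X Y Z p)"
    using assms by blast
next
  fix u
  assume u: "u \<in> Tan p \<and> (\<forall>X\<in>fld p. \<forall>Z\<in>fld p. X p = v \<longrightarrow> 2 * G p u (Z p) = koszul D br G X Y Z p)"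
  have "2 * G p u (Z p) = 2 * G p w (Z p)" if "Z \<in> fld p" for Z
    using u assms(2)[OF assms(3) that assms(4)] assms(3,4) that by simp
  then show "u = w" using u assms(5) by simp
qed

section \<open>The connection of the warped product\<close>

lemma bounded_bilinear_flat_form: "bounded_bilinear (flat_form c)"
  unfolding bilinear_conv_bounded_bilinear[symmetric] bilinear_def flat_form_def
  by (auto intro!: linearI simp: algebra_simps)

lemmas flat_form_has_derivative = bounded_bilinear.FDERIV[OF bounded_bilinear_flat_form]

lemma flat_form_commute: "flat_form c v w = flat_form c w v"
  by (simp add: flat_form_def)

lemma flat_form_linear [simp]:
  "flat_form c (u + v) w = flat_form c u w + flat_form c v w"
  "flat_form c w (u + v) = flat_form c w u + flat_form c w v"
  "flat_form c (u - v) w = flat_form c u w - flat_form c v w"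
  "flat_form c w (u - v) = flat_form c w u - flat_form c w v"
  "flat_form c (- u) w = - flat_form c u w"
  "flat_form c w (- u) = - flat_form c w u"
  "flat_form c (a *\<^sub>R u) w = a * flat_form c u w"
  "flat_form c w (a *\<^sub>R u) = a * flat_form c w u"
  "flat_form c 0 w = 0"
  "flat_form c w 0 = 0"
  by (simp_all add: flat_form_def algebra_simps)

lemma flat_form_nondegenerate:
  assumes "\<And>u. flat_form c w u = 0"
  shows "w = 0"
proof -
  have "w $ i = 0" for i
  proof -
    have "flat_form c w (axis i 1) = 0" by (rule assms)
    then show ?thesis
      using exhaust_4[of i] by (auto simp: flat_form_def axis_def split: if_splits)
  qed
  then show ?thesis by (simp add: vec_eq_iff)
qed

lemma warped_metric_commute: "warped_metric c f q v w = warped_metric c f q w v"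
  by (simp add: warped_metric_def flat_form_commute)

lemma warped_metric_linear [simp]:
  "warped_metric c f q (u + v) w = warped_metric c f q u w + warped_metric c f q v w"
  "warped_metric c f q w (u + v) = warped_metric c f q w u + warped_metric c f q w v"
  "warped_metric c f q (u - v) w = warped_metric c f q u w - warped_metric c f q v w"
  "warped_metric c f q w (u - v) = warped_metric c f q w u - warped_metric c f q w v"
  "warped_metric c f q (- u) w = - warped_metric c f q u w"
  "warped_metric c f q w (- u) = - warped_metric c f q w u"
  "warped_metric c f q (a *\<^sub>R u) w = a * warped_metric c f q u w"
  "warped_metric c f q w (a *\<^sub>R u) = a * warped_metric c f q w u"
  "warped_metric c f q 0 w = 0"
  "warped_metric c f q w 0 = 0"
  by (simp_all add: warped_metric_def algebra_simps)

lemma warped_metric_d_dz [simp]: "warped_metric c f q v d_dz = snd v"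
  "warped_metric c f q d_dz v = snd v"
  by (simp_all add: warped_metric_def d_dz_def)

lemma warped_tangent_linear:
  "v \<in> warped_tangent c q \<Longrightarrow> w \<in> warped_tangent c q \<Longrightarrow> v + w \<in> warped_tangent c q"
  "v \<in> warped_tangent c q \<Longrightarrow> w \<in> warped_tangent c q \<Longrightarrow> v - w \<in> warped_tangent c q"
  "v \<in> warped_tangent c q \<Longrightarrow> a *\<^sub>R v \<in> warped_tangent c q"
  "d_dz \<in> warped_tangent c q"
  by (auto simp: warped_tangent_def space_form_tangent_def d_dz_def)

lemma warped_tangent_orthogonal:
  "v \<in> warped_tangent c q \<Longrightarrow> c * flat_form c (fst q) (fst v) = 0"
  by (auto simp: warped_tangent_def space_form_tangent_def split: if_splits)

text \<open>
  The difference between the Levi-Civita connection of the warped product and the flat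
  derivative of \<open>\<real>\<^sup>4 \<times> \<real>\<close>. The term with \<open>c\<close> is the correction for the hyperquadric, whose
  normal at \<open>x\<close> is \<open>x\<close> itself; the other two come from differentiating the factor \<open>f\<^sup>2\<close>.
\<close>

definition christoffel :: "real \<Rightarrow> (real \<Rightarrow> real) \<Rightarrow> ambient \<Rightarrow> ambient \<Rightarrow> ambient \<Rightarrow> ambient" where
  "christoffel c f q v w =
     ((c * flat_form c (fst v) (fst w)) *\<^sub>R fst q
        + (deriv f (snd q) / f (snd q)) *\<^sub>R (snd v *\<^sub>R fst w + snd w *\<^sub>R fst v),
      - (f (snd q) * deriv f (snd q) * flat_form c (fst v) (fst w)))"

lemma christoffel_commute: "christoffel c f q v w = christoffel c f q w v"
  by (simp add: christoffel_def flat_form_commute add.commute)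

lemma christoffel_linear:
  "christoffel c f q v (u + w) = christoffel c f q v u + christoffel c f q v w"
  "christoffel c f q v (a *\<^sub>R w) = a *\<^sub>R christoffel c f q v w"
  by (simp_all add: christoffel_def algebra_simps)

lemma linear_christoffel: "linear (christoffel c f q v)"
  by (rule linearI) (simp_all add: christoffel_linear)

text \<open>
  As \<open>d_dz\<close> is a constant map into \<open>\<real>\<^sup>4 \<times> \<real>\<close>, this value is its whole covariant derivative.
\<close>

lemma christoffel_d_dz:
  "christoffel c f q v d_dz = (deriv f (snd q) / f (snd q)) *\<^sub>R (v - snd v *\<^sub>R d_dz)"
  by (simp add: christoffel_def d_dz_def prod_eq_iff)

text \<open>
  The hyperquadric term of \<open>christoffel\<close> points along the position vector and is invisible to
  a tangent vector \<open>z\<close>.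
\<close>

lemma warped_metric_christoffel:
  assumes "f (snd q) \<noteq> 0" "c * flat_form c (fst q) (fst z) = 0"
  shows "warped_metric c f q (christoffel c f q v y) z =
    f (snd q) * deriv f (snd q) * (snd v * flat_form c (fst y) (fst z)
      + snd y * flat_form c (fst v) (fst z) - snd z * flat_form c (fst v) (fst y))"
proof -
  have "c * (flat_form c (fst v) (fst y) * flat_form c (fst q) (fst z)) = 0"
    using assms(2) by auto
  then show ?thesis
    using assms(1)
    by (simp add: warped_metric_def christoffel_def algebra_simps power2_eq_square)
qed

text \<open>
  The metric property of the connection, for fields \<open>Y\<close>, \<open>Z\<close> along an arbitrary map \<open>F\<close>. With
  \<open>F = id\<close> it applies to vector fields of the warped product, with a parametrised surface as \<open>F\<close> to
  fields along that surface.
\<close>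

lemma warped_metric_has_derivative:
  assumes F: "(F has_derivative F') (at P)"
    and Y: "(Y has_derivative Y') (at P)" and Z: "(Z has_derivative Z') (at P)"
    and f: "f differentiable at (snd (F P))" "f (snd (F P)) \<noteq> 0"
    and tangent: "c * flat_form c (fst (F P)) (fst (Y P)) = 0"
      "c * flat_form c (fst (F P)) (fst (Z P)) = 0"
  shows "((\<lambda>r. warped_metric c f (F r) (Y r) (Z r)) has_derivative
    (\<lambda>a. warped_metric c f (F P) (Y' a + christoffel c f (F P) (F' a) (Y P)) (Z P)
       + warped_metric c f (F P) (Y P) (Z' a + christoffel c f (F P) (F' a) (Z P)))) (at P)"
proof -
  have "(f has_derivative (*) (deriv f (snd (F P)))) (at (snd (F P)))"
    using f(1) by (simp add: DERIV_deriv_iff_real_differentiable flip: has_field_derivative_def)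
  from has_derivative_compose[OF has_derivative_snd[OF F] this]
  have "((\<lambda>r. f (snd (F r))) has_derivative (\<lambda>a. deriv f (snd (F P)) * snd (F' a))) (at P)"
    by simp
  then have "((\<lambda>r. warped_metric c f (F r) (Y r) (Z r)) has_derivative
    (\<lambda>a. 2 * f (snd (F P)) * (deriv f (snd (F P)) * snd (F' a))
           * flat_form c (fst (Y P)) (fst (Z P))
       + (f (snd (F P)))\<^sup>2 * (flat_form c (fst (Y P)) (fst (Z' a)) + flat_form c (fst (Y' a)) (fst (Z P)))
       + (snd (Y P) * snd (Z' a) + snd (Y' a) * snd (Z P)))) (at P)"
    unfolding warped_metric_def
    by (auto intro!: derivative_eq_intros flat_form_has_derivative
        has_derivative_fst has_derivative_snd Y Z)
  moreover have "2 * f (snd (F P)) * (deriv f (snd (F P)) * snd (F' a))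
           * flat_form c (fst (Y P)) (fst (Z P))
       + (f (snd (F P)))\<^sup>2 * (flat_form c (fst (Y P)) (fst (Z' a)) + flat_form c (fst (Y' a)) (fst (Z P)))
       + (snd (Y P) * snd (Z' a) + snd (Y' a) * snd (Z P)) =
     warped_metric c f (F P) (Y' a + christoffel c f (F P) (F' a) (Y P)) (Z P)
       + warped_metric c f (F P) (Y P) (Z' a + christoffel c f (F P) (F' a) (Z P))" for a
  proof -
    have "warped_metric c f (F P) (Y P) (christoffel c f (F P) (F' a) (Z P)) =
        f (snd (F P)) * deriv f (snd (F P)) * (snd (F' a) * flat_form c (fst (Y P)) (fst (Z P))
      + snd (Z P) * flat_form c (fst (F' a)) (fst (Y P)) - snd (Y P) * flat_form c (fst (F' a)) (fst (Z P)))"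
      using warped_metric_christoffel[of f "F P" c "Y P", OF f(2) tangent(1)]
      by (simp add: warped_metric_commute[of c f _ "Y P"] flat_form_commute[of c "fst (Y P)"])
    then show ?thesis
      using warped_metric_christoffel[of f "F P" c "Z P" "F' a" "Y P", OF f(2) tangent(2)]
      by (simp add: warped_metric_def[of c f "F P" "Y' a"] warped_metric_def[of c f "F P" "Y P" "Z' a"]
          algebra_simps)
  qed
  ultimately show ?thesis by (rule_tac has_derivative_eq_rhs) (auto simp: fun_eq_iff)
qed

text \<open>
  A smooth field on all of \<open>\<real>\<^sup>4 \<times> \<real>\<close> that is tangent to the warped product and extends any given tangent
  vector: the projection of a constant field along the position vector, or, for \<open>c = 0\<close>, along the
  fourth axis.
\<close>

definition tangential_extension :: "real \<Rightarrow> ambient \<Rightarrow> ambient \<Rightarrow> ambient" where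
  "tangential_extension c u r =
     (if c = 0 then fst u - (fst u $ 4) *\<^sub>R axis 4 1
      else fst u - (c * flat_form c (fst u) (fst r)) *\<^sub>R fst r, snd u)"

lemma tangential_extension_tangent:
  assumes "c \<in> {-1, 0, 1}" "r \<in> warped c I"
  shows "tangential_extension c u r \<in> warped_tangent c r"
  using assms
  by (auto simp: tangential_extension_def warped_tangent_def warped_def space_form_def
      space_form_tangent_def flat_form_commute)

lemma tangential_extension_eq:
  "u \<in> warped_tangent c r \<Longrightarrow> tangential_extension c u r = u"
  using warped_tangent_orthogonal[of u c r]
  by (auto simp: tangential_extension_def prod_eq_iff flat_form_commute warped_tangent_def
      space_form_tangent_def)

lemma linear_tangential_extension: "linear (\<lambda>u. tangential_extension c u r)"
  by (rule linearI) (auto simp: tangential_extension_def algebra_simps)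

lemma smooth_on_tangential_extension: "smooth_on S (tangential_extension c u)"
proof -
  define k where "k = (if c = 0 then 0 else c)"
  define A where "A = (if c = 0 then fst u - (fst u $ 4) *\<^sub>R axis 4 1 else fst u, snd u)"
  have "bounded_bilinear (\<lambda>(x :: ambient) (y :: ambient).
      (- ((k * flat_form c (fst u) (fst x)) *\<^sub>R fst y), 0 :: real))"
    unfolding bilinear_conv_bounded_bilinear[symmetric] bilinear_def
    by (auto intro!: linearI simp: algebra_simps)
  from smooth_on_quadratic[OF this, of S A] show ?thesis
    by (cases "c = 0") (simp_all add: tangential_extension_def[abs_def] plus_prod_def k_def A_def)
qed

lemma tangential_extension_in_warped_fields:
  assumes "c \<in> {-1, 0, 1}"
  shows "tangential_extension c u \<in> warped_fields c I q"
  unfolding warped_fields_def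
  using smooth_on_tangential_extension[of UNIV c u] tangential_extension_tangent[OF assms]
  by (intro CollectI exI[of _ UNIV]) blast

text \<open>
  A vector \<open>w\<close> tangent to the warped product is also orthogonal to the direction of projection, so
  being orthogonal to the projection of \<open>u\<close> is the same as being orthogonal to \<open>u\<close>; the form
  on \<open>\<real>\<^sup>4 \<times> \<real>\<close> is non-degenerate.
\<close>

lemma warped_metric_nondegenerate:
  assumes "c \<in> {-1, 0, 1}" "q \<in> warped c I" "f (snd q) \<noteq> 0" "w \<in> warped_tangent c q"
    and "\<And>u. u \<in> warped_tangent c q \<Longrightarrow> warped_metric c f q w u = 0"
  shows "w = 0"
proof -
  have "warped_metric c f q w u = 0" for u
  proof -
    have "warped_metric c f q w (tangential_extension c u q) = 0"
      using tangential_extension_tangent[OF assms(1,2)] assms(5) by blast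
    moreover have "flat_form c (fst w) (axis 4 1) = 0" if "c = 0"
      using assms(4) that
      by (simp add: warped_tangent_def space_form_tangent_def flat_form_def axis_def mem_Times_iff)
    moreover have "flat_form c (fst w) (fst q) = 0" if "c \<noteq> 0"
      using warped_tangent_orthogonal[OF assms(4)] that by (simp add: flat_form_commute)
    ultimately show ?thesis
      by (cases "c = 0") (simp_all add: warped_metric_def tangential_extension_def)
  qed
  from this[of "(_, 0)"] this[of "(0, 1)"] show ?thesis
    using assms(3) by (auto simp: warped_metric_def prod_eq_iff intro: flat_form_nondegenerate)
qed

lemma has_derivative_zero_on_open:
  assumes "(h has_derivative h') (at P)" "open N" "P \<in> N" "\<And>r. r \<in> N \<Longrightarrow> h r = C"
  shows "h' a = 0"
proof -
  have "((\<lambda>r. C) has_derivative h') (at P)"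
    using has_derivative_transform_within_open[OF assms(1-3)] assms(4) by simp
  then show ?thesis
    using has_derivative_unique[OF _ has_derivative_const] by (metis (full_types))
qed

text \<open>
  Obtained by differentiating the equation of the space form along \<open>F\<close>.
\<close>

lemma derivative_tangent_to_warped:
  assumes c: "c \<in> {-1, 0, 1}" and N: "open N" "P \<in> N"
    and F: "(F has_derivative F') (at P)" "\<And>r. r \<in> N \<Longrightarrow> F r \<in> warped c I"
  shows "F' a \<in> warped_tangent c (F P)"
proof (cases "c = 0")
  case True
  have "((\<lambda>r. fst (F r) $ 4) has_derivative (\<lambda>a. fst (F' a) $ 4)) (at P)"
    by (intro bounded_linear.has_derivative[OF bounded_linear_vec_nth] has_derivative_fst F)
  from has_derivative_zero_on_open[OF this N, of 0] F(2) True show ?thesis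
    by (auto simp: warped_def space_form_def warped_tangent_def space_form_tangent_def mem_Times_iff)
next
  case False
  note flat_form_has_derivative[OF has_derivative_fst has_derivative_fst, OF F(1) F(1), of c]
  from has_derivative_zero_on_open[OF this N, of c a] F(2) False show ?thesis
    by (auto simp: warped_def space_form_def warped_tangent_def space_form_tangent_def
        flat_form_commute mem_Times_iff)
qed

text \<open>
  Differentiating \<open>\<langle>F, Y\<rangle> = 0\<close> along \<open>F\<close> gives \<open>\<langle>F, Y' a\<rangle> = -\<langle>F' a, Y\<rangle>\<close>, and the hyperquadric
  term of \<open>christoffel\<close> contributes \<open>c\<^sup>2 \<langle>F' a, Y\<rangle> = \<langle>F' a, Y\<rangle>\<close>.
\<close>

lemma covariant_derivative_tangent_to_warped:
  assumes c: "c \<in> {-1, 0, 1}" and N: "open N" "P \<in> N"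
    and F: "(F has_derivative F') (at P)" "\<And>r. r \<in> N \<Longrightarrow> F r \<in> warped c I"
    and Y: "(Y has_derivative Y') (at P)" "\<And>r. r \<in> N \<Longrightarrow> Y r \<in> warped_tangent c (F r)"
  shows "Y' a + christoffel c f (F P) (F' a) (Y P) \<in> warped_tangent c (F P)"
proof -
  have F': "F' a \<in> warped_tangent c (F P)"
    by (rule derivative_tangent_to_warped[OF c N F])
  show ?thesis
  proof (cases "c = 0")
    case True
    have "((\<lambda>r. fst (Y r) $ 4) has_derivative (\<lambda>a. fst (Y' a) $ 4)) (at P)"
      by (intro bounded_linear.has_derivative[OF bounded_linear_vec_nth] has_derivative_fst Y)
    from has_derivative_zero_on_open[OF this N, of 0] Y(2) Y(2)[OF N(2)] F' True show ?thesis
      by (auto simp: warped_tangent_def space_form_tangent_def christoffel_def mem_Times_iff)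
  next
    case False
    note flat_form_has_derivative[OF has_derivative_fst has_derivative_fst, OF F(1) Y(1), of c]
    from has_derivative_zero_on_open[OF this N, of 0 a] Y(2) False
    have "flat_form c (fst (F P)) (fst (Y' a)) + flat_form c (fst (F' a)) (fst (Y P)) = 0"
      by (auto simp: warped_tangent_def space_form_tangent_def mem_Times_iff)
    moreover have "flat_form c (fst (F P)) (fst (F P)) = c"
      using F(2)[OF N(2)] False by (auto simp: warped_def space_form_def mem_Times_iff)
    moreover have "c = 1 \<or> c = -1" using c False by auto
    ultimately show ?thesis
      using F' Y(2)[OF N(2)]
      by (auto simp: warped_tangent_def space_form_tangent_def christoffel_def mem_Times_iff)
  qed
qed

lemma warped_fields_differentiable:
  "X \<in> warped_fields c I q \<Longrightarrow> (X has_derivative frechet_derivative X (at q)) (at q)"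
  by (auto simp: warped_fields_def frechet_derivative_works[symmetric] intro: smooth_on_differentiable)

lemma warped_fields_tangent:
  "X \<in> warped_fields c I q \<Longrightarrow> q \<in> warped c I \<Longrightarrow> X q \<in> warped_tangent c q"
  by (auto simp: warped_fields_def)

text \<open>
  The direction of differentiation is taken to be a velocity \<open>F' a\<close> of some map into
  the warped product: this is how tangency of the covariant derivative is proved, and it covers all tangent
  vectors of surfaces.
\<close>

proposition warped_nabla_eq:
  assumes c: "c \<in> {-1, 0, 1}" and f: "f differentiable at (snd (F P))" "f (snd (F P)) \<noteq> 0"
    and N: "open N" "P \<in> N"
    and F: "(F has_derivative F') (at P)" "\<And>r. r \<in> N \<Longrightarrow> F r \<in> warped c I"
    and V: "V \<in> warped_fields c I (F P)"
  shows "warped_nabla c I f (F' a) V (F P) =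
    frechet_derivative V (at (F P)) (F' a) + christoffel c f (F P) (F' a) (V (F P))"
    (is "_ = ?w")
  unfolding warped_nabla_def
proof (rule levi_civita_eqI[where ?X0.0 = "tangential_extension c (F' a)"])
  define q where "q = F P"
  have q: "q \<in> warped c I" using F(2) N(2) by (simp add: q_def)
  note f' = f[folded q_def]
  have F': "F' a \<in> warped_tangent c q"
    unfolding q_def by (rule derivative_tangent_to_warped[OF c N F])
  obtain W where W: "open W" "q \<in> W" "\<And>r. r \<in> W \<inter> warped c I \<Longrightarrow> V r \<in> warped_tangent c r"
    using V by (auto simp: warped_fields_def q_def)
  have "isCont F P" using F(1) by (rule has_derivative_continuous)
  then obtain N' where N': "open N'" "P \<in> N'" "\<And>r. r \<in> N' \<Longrightarrow> F r \<in> W"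
    using W(1,2) by (metis continuous_at_open q_def)
  show "?w \<in> warped_tangent c (F P)"
  proof (rule covariant_derivative_tangent_to_warped[OF c, where N = "N \<inter> N'" and Y = "\<lambda>r. V (F r)"])
    show "open (N \<inter> N')" "P \<in> N \<inter> N'" using N N' by auto
    show "(F has_derivative F') (at P)" by (rule F)
    show "((\<lambda>r. V (F r)) has_derivative (\<lambda>a. frechet_derivative V (at (F P)) (F' a))) (at P)"
      by (rule has_derivative_compose[OF F(1) warped_fields_differentiable[OF V]])
  qed (use F W N' in auto)
  show "tangential_extension c (F' a) \<in> warped_fields c I (F P)"
    using c by (rule tangential_extension_in_warped_fields)
  show "tangential_extension c (F' a) (F P) = F' a"
    using F' unfolding q_def by (rule tangential_extension_eq)
  define n where "n A B = frechet_derivative B (at q) (A q) + christoffel c f q (A q) (B q)"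
    for A B :: "ambient \<Rightarrow> ambient"
  have compat: "frechet_derivative (\<lambda>r. warped_metric c f r (A r) (B r)) (at q) (C q) =
      warped_metric c f q (n C A) (B q) + warped_metric c f q (A q) (n C B)"
    if "A \<in> warped_fields c I q" "B \<in> warped_fields c I q" for A B C
    unfolding n_def
    by (rule fun_cong[OF frechet_derivative_at[OF warped_metric_has_derivative[where F = "\<lambda>r. r",
        OF has_derivative_ident
        warped_fields_differentiable[OF that(1)] warped_fields_differentiable[OF that(2)] f'
        warped_tangent_orthogonal[OF warped_fields_tangent[OF that(1) q]]
        warped_tangent_orthogonal[OF warped_fields_tangent[OF that(2) q]]]], symmetric])
  show "2 * warped_metric c f (F P) ?w (Z (F P)) =
      koszul (\<lambda>h q. frechet_derivative h (at q)) ambient_bracket (warped_metric c f) X V Z (F P)"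
    if "X \<in> warped_fields c I (F P)" "Z \<in> warped_fields c I (F P)" "X (F P) = F' a" for X Z
  proof -
    note fields = that(1,2)[folded q_def] V[folded q_def]
    have "koszul (\<lambda>h q. frechet_derivative h (at q)) ambient_bracket (warped_metric c f) X V Z q =
        2 * warped_metric c f q (n X V) (Z q)"
    proof (rule koszul_metric_torsion_free)
      show "ambient_bracket A B q = n A B - n B A" for A B
        using christoffel_commute[of c f q "A q" "B q"] by (simp add: ambient_bracket_def n_def)
    qed (rule compat fields warped_metric_linear(3) warped_metric_commute)+
    then show ?thesis using that by (simp add: n_def q_def)
  qed
  show "u = ?w" if u: "u \<in> warped_tangent c (F P)"
    "\<And>Z. Z \<in> warped_fields c I (F P) \<Longrightarrow>
      warped_metric c f (F P) u (Z (F P)) = warped_metric c f (F P) ?w (Z (F P))" for u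
  proof -
    have "warped_metric c f q (u - ?w) z = 0" if "z \<in> warped_tangent c q" for z
      using u(2)[of "tangential_extension c z", OF tangential_extension_in_warped_fields[OF c]]
        tangential_extension_eq[OF that]
      by (simp add: q_def)
    then have "u - ?w = 0"
      using c q f'(2) u(1) \<open>?w \<in> warped_tangent c (F P)\<close>
      by (intro warped_metric_nondegenerate) (auto intro: warped_tangent_linear simp: q_def)
    then show ?thesis by simp
  qed
qed

section \<open>Calculus on an immersed surface\<close>

text \<open>
  Required in every chart around the point, because \<open>surface_deriv\<close> is a definite description that ranges
  over all of them.
\<close>

definition differentiable_in_charts ::
  "'m surface \<Rightarrow> 'm \<Rightarrow> ('m \<Rightarrow> 'b::real_normed_vector) \<Rightarrow> bool" where
  "differentiable_in_charts M p h \<longleftrightarrow>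
     (\<forall>(U,\<phi>)\<in>charts M. p \<in> U \<longrightarrow> (h \<circ> inv_into U \<phi>) differentiable (at (\<phi> p)))"

lemma surface_smooth_on_imp_differentiable:
  "surface_smooth_on M W h \<Longrightarrow> p \<in> W \<Longrightarrow> differentiable_in_charts M p h"
  unfolding surface_smooth_on_def differentiable_in_charts_def
  by (fast intro: smooth_on_differentiable)

text \<open>
  The explicit form of the pulled-back connection, in direction \<open>v\<close>.
\<close>

definition pullback_derivative ::
  "real \<Rightarrow> (real \<Rightarrow> real) \<Rightarrow> 'm surface \<Rightarrow> ambient \<Rightarrow> ('m \<Rightarrow> ambient) \<Rightarrow> 'm \<Rightarrow> ambient" where
  "pullback_derivative c f M v Y p = surface_deriv M Y p v + christoffel c f (imm M p) v (Y p)"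

locale immersed_surface =
  fixes c :: real and I :: "real set" and f :: "real \<Rightarrow> real" and M :: "'m surface"
  assumes c: "c \<in> {-1, 0, 1}"
    and f: "smooth_on I f" "\<forall>z\<in>I. f z > 0"
    and M: "smooth_2_manifold M" "immersed_in_warped c I M"

locale surface_chart = immersed_surface c I f M
  for c :: real and I :: "real set" and f :: "real \<Rightarrow> real" and M :: "'m surface" +
  fixes U :: "'m set" and \<phi> :: "'m \<Rightarrow> real^2" and p :: 'm
  assumes chart: "(U, \<phi>) \<in> charts M" and p: "p \<in> U"
begin

abbreviation E :: "real^2 \<Rightarrow> 'm" where "E \<equiv> inv_into U \<phi>"
abbreviation P :: "real^2" where "P \<equiv> \<phi> p"
abbreviation dF :: "real^2 \<Rightarrow> ambient" where "dF \<equiv> frechet_derivative (imm M \<circ> E) (at P)"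

lemma inj_chart: "inj_on \<phi> U" and openin_chart: "openin (topo M) U"
  and chart_openin: "openin (topo M) W \<Longrightarrow> open (\<phi> ` (U \<inter> W))"
proof -
  have ch: "openin (topo M) U" "open (\<phi> ` U)"
    "homeomorphic_map (subtopology (topo M) U) (top_of_set (\<phi> ` U)) \<phi>"
    using M(1) chart unfolding smooth_2_manifold_def by blast+
  then show "openin (topo M) U" by blast
  have "topspace (subtopology (topo M) U) = U"
    using openin_subset[OF ch(1)] by auto
  then show "inj_on \<phi> U"
    using homeomorphic_imp_injective_map[OF ch(3)] by simp
  assume "openin (topo M) W"
  then have "openin (subtopology (topo M) U) (U \<inter> W)"
    by (metis Int_commute openin_subtopology_Int)
  then have "openin (top_of_set (\<phi> ` U)) (\<phi> ` (U \<inter> W))"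
    using homeomorphic_imp_open_map[OF ch(3)] by (simp add: open_map_def)
  then show "open (\<phi> ` (U \<inter> W))"
    using ch(2) openin_open_eq by blast
qed

lemma p_in_pts: "p \<in> pts M"
  using openin_subset[OF openin_chart] p by auto

lemma E_P [simp]: "E P = p"
  using inj_chart p by simp

lemma E_in: "r \<in> \<phi> ` (U \<inter> W) \<Longrightarrow> E r \<in> U \<inter> W" and \<phi>_E: "r \<in> \<phi> ` (U \<inter> W) \<Longrightarrow> \<phi> (E r) = r"
  using inj_chart by auto

text \<open>
  The chain rule for a transition map. Applied to the immersion it shows that coordinates
  representing the same tangent vector in two charts correspond under the derivative of the transition
  map; applied to any other function it then shows that \<open>surface_deriv\<close> is independent of the chart.
\<close>

lemma chart_change:
  fixes h :: "'m \<Rightarrow> 'b::real_normed_vector"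
  assumes V: "(V, \<psi>) \<in> charts M" "p \<in> V" and h: "differentiable_in_charts M p h"
  shows "frechet_derivative (h \<circ> E) (at P) a =
    frechet_derivative (h \<circ> inv_into V \<psi>) (at (\<psi> p)) (frechet_derivative (\<psi> \<circ> E) (at P) a)"
proof -
  interpret V: surface_chart c I f M V \<psi> p by unfold_locales (use V in auto)
  define \<tau> where "\<tau> = frechet_derivative (\<psi> \<circ> E) (at P)"
  have "smooth_on (\<phi> ` (U \<inter> V)) (\<psi> \<circ> E)"
    using M(1) chart V(1) unfolding smooth_2_manifold_def by fast
  then have \<tau>: "((\<lambda>r. \<psi> (E r)) has_derivative \<tau>) (at P)"
    using smooth_on_differentiable[of _ "\<psi> \<circ> E" P] p V(2)
    unfolding \<tau>_def by (simp add: frechet_derivative_works o_def)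
  have "((h \<circ> V.E) has_derivative frechet_derivative (h \<circ> V.E) (at (\<psi> p))) (at (\<psi> (E P)))"
    using h V unfolding differentiable_in_charts_def
    by (auto simp: frechet_derivative_works[symmetric])
  from has_derivative_compose[OF \<tau> this]
  have "((\<lambda>r. h (V.E (\<psi> (E r)))) has_derivative
      (\<lambda>a. frechet_derivative (h \<circ> V.E) (at (\<psi> p)) (\<tau> a))) (at P)"
    by (simp add: o_def)
  moreover have "P \<in> \<phi> ` (U \<inter> V)" using p V(2) by blast
  moreover have "h (V.E (\<psi> (E r))) = (h \<circ> E) r" if "r \<in> \<phi> ` (U \<inter> V)" for r
    using E_in[OF that] V.inj_chart by simp
  ultimately have "((h \<circ> E) has_derivative
      (\<lambda>a. frechet_derivative (h \<circ> V.E) (at (\<psi> p)) (\<tau> a))) (at P)"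
    by (rule has_derivative_transform_within_open[OF _ chart_openin[OF V.openin_chart]])
  from frechet_derivative_at[OF this] show ?thesis
    by (simp add: \<tau>_def fun_eq_iff)
qed

lemma imm_differentiable: "differentiable_in_charts M p (imm M)"
proof (rule surface_smooth_on_imp_differentiable)
  show "surface_smooth_on M (pts M) (imm M)"
    using M(2) by (simp add: immersed_in_warped_def)
qed (rule p_in_pts)

lemma dF_has_derivative: "((\<lambda>r. imm M (E r)) has_derivative dF) (at P)"
  using imm_differentiable chart p
  by (auto simp: differentiable_in_charts_def frechet_derivative_works o_def)

lemma has_derivative_in_chart:
  "differentiable_in_charts M p h \<Longrightarrow>
    ((\<lambda>r. h (E r)) has_derivative frechet_derivative (h \<circ> E) (at P)) (at P)"
  using chart p by (auto simp: differentiable_in_charts_def frechet_derivative_works o_def)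

lemma surface_deriv_chart:
  assumes h: "differentiable_in_charts M p h"
  shows "surface_deriv M h p (dF a) = frechet_derivative (h \<circ> E) (at P) a"
  unfolding surface_deriv_def
proof (rule the_equality)
  show "\<exists>(U, \<phi>)\<in>charts M. p \<in> U \<and> (\<exists>b. dF a = frechet_derivative (imm M \<circ> inv_into U \<phi>) (at (\<phi> p)) b \<and>
      frechet_derivative (h \<circ> E) (at P) a = frechet_derivative (h \<circ> inv_into U \<phi>) (at (\<phi> p)) b)"
    using chart p by blast
next
  fix d
  assume "\<exists>(U, \<phi>)\<in>charts M. p \<in> U \<and>
      (\<exists>b. dF a = frechet_derivative (imm M \<circ> inv_into U \<phi>) (at (\<phi> p)) b \<and>
          d = frechet_derivative (h \<circ> inv_into U \<phi>) (at (\<phi> p)) b)"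
  then obtain V \<psi> b where V: "(V, \<psi>) \<in> charts M" "p \<in> V"
    and b: "dF a = frechet_derivative (imm M \<circ> inv_into V \<psi>) (at (\<psi> p)) b"
      "d = frechet_derivative (h \<circ> inv_into V \<psi>) (at (\<psi> p)) b"
    by blast
  have "inj (frechet_derivative (imm M \<circ> inv_into V \<psi>) (at (\<psi> p)))"
    using M(2) V unfolding immersed_in_warped_def by blast
  then have "b = frechet_derivative (\<psi> \<circ> E) (at P) a"
    using b(1) chart_change[OF V imm_differentiable, of a] by (simp add: inj_eq)
  then show "d = frechet_derivative (h \<circ> E) (at P) a"
    using b(2) chart_change[OF V h, of a] by simp
qed

lemma tangent_plane_chart: "tangent_plane M p = range dF"
proof
  show "range dF \<subseteq> tangent_plane M p"
    unfolding tangent_plane_def using chart p by blast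
  show "tangent_plane M p \<subseteq> range dF"
  proof
    fix v assume "v \<in> tangent_plane M p"
    then obtain V \<psi> b where V: "(V, \<psi>) \<in> charts M" "p \<in> V"
      and b: "v = frechet_derivative (imm M \<circ> inv_into V \<psi>) (at (\<psi> p)) b"
      unfolding tangent_plane_def by blast
    interpret V: surface_chart c I f M V \<psi> p by unfold_locales (use V in auto)
    show "v \<in> range dF"
      using V.chart_change[OF chart p imm_differentiable, of b] b by blast
  qed
qed

lemma linear_dF: "linear dF"
  using dF_has_derivative by (rule has_derivative_linear)

lemma imm_in_warped: "r \<in> \<phi> ` U \<Longrightarrow> imm M (E r) \<in> warped c I"
  using M(2) E_in[of r UNIV] openin_subset[OF openin_chart]
  unfolding immersed_in_warped_def by auto

lemma open_chart: "open (\<phi> ` U)" and P_in: "P \<in> \<phi> ` U"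
  using chart_openin[OF openin_chart] p by auto

lemma f_at: "f differentiable at (snd (imm M p))" "f (snd (imm M p)) \<noteq> 0"
  using imm_in_warped[OF P_in] f smooth_on_differentiable[of I f]
  by (auto simp: warped_def mem_Times_iff dest!: bspec)

lemma tangent_plane_subset: "tangent_plane M p \<subseteq> warped_tangent c (imm M p)"
  using derivative_tangent_to_warped[OF c open_chart P_in dF_has_derivative imm_in_warped]
  by (auto simp: tangent_plane_chart)

lemma pullback_derivative_chart:
  assumes "differentiable_in_charts M p Y"
  shows "pullback_derivative c f M (dF a) Y p =
    frechet_derivative (Y \<circ> E) (at P) a + christoffel c f (imm M p) (dF a) (Y p)"
  using assms by (simp add: pullback_derivative_def surface_deriv_chart)

lemma metric_has_derivative_chart:
  assumes Y: "differentiable_in_charts M p Y" "Y p \<in> warped_tangent c (imm M p)"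
    and Z: "differentiable_in_charts M p Z" "Z p \<in> warped_tangent c (imm M p)"
  shows "((\<lambda>r. induced_metric c f M r (Y r) (Z r)) \<circ> E has_derivative
    (\<lambda>a. induced_metric c f M p (pullback_derivative c f M (dF a) Y p) (Z p)
       + induced_metric c f M p (Y p) (pullback_derivative c f M (dF a) Z p))) (at P)"
proof -
  have "c * flat_form c (fst (imm M p)) (fst (Y p)) = 0"
    "c * flat_form c (fst (imm M p)) (fst (Z p)) = 0"
    by (intro warped_tangent_orthogonal Y Z)+
  note D = warped_metric_has_derivative[OF dF_has_derivative has_derivative_in_chart[OF Y(1)]
      has_derivative_in_chart[OF Z(1)], of f c, unfolded E_P, OF f_at this]
  have "(\<lambda>r. induced_metric c f M r (Y r) (Z r)) \<circ> E =
      (\<lambda>r. warped_metric c f (imm M (E r)) (Y (E r)) (Z (E r)))"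
    by (simp add: fun_eq_iff induced_metric_def)
  then show ?thesis
    using D by (simp only: induced_metric_def pullback_derivative_chart[OF Y(1)]
        pullback_derivative_chart[OF Z(1)])
qed

end

context immersed_surface
begin

lemma chart_exists:
  assumes "p \<in> pts M"
  obtains U \<phi> where "surface_chart c I f M U \<phi> p"
proof -
  have "\<Union> (fst ` charts M) = pts M"
    using M(1) by (simp add: smooth_2_manifold_def)
  then obtain x where "x \<in> charts M" "p \<in> fst x"
    using assms by blast
  then have "surface_chart c I f M (fst x) (snd x) p"
    by unfold_locales auto
  then show ?thesis by (rule that)
qed

lemma metric_differentiable:
  assumes "differentiable_in_charts M p Y" "Y p \<in> warped_tangent c (imm M p)"
    and "differentiable_in_charts M p Z" "Z p \<in> warped_tangent c (imm M p)"
  shows "differentiable_in_charts M p (\<lambda>r. induced_metric c f M r (Y r) (Z r))"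
  unfolding differentiable_in_charts_def
proof clarify
  fix U \<phi> assume "(U, \<phi>) \<in> charts M" "p \<in> U"
  then interpret surface_chart c I f M U \<phi> p by unfold_locales
  show "(\<lambda>r. induced_metric c f M r (Y r) (Z r)) \<circ> E differentiable at P"
    using metric_has_derivative_chart[OF assms] by (rule differentiableI)
qed

lemma pullback_derivative_metric:
  assumes "p \<in> pts M" "v \<in> tangent_plane M p"
    and Y: "differentiable_in_charts M p Y" "Y p \<in> warped_tangent c (imm M p)"
    and Z: "differentiable_in_charts M p Z" "Z p \<in> warped_tangent c (imm M p)"
  shows "surface_deriv M (\<lambda>r. induced_metric c f M r (Y r) (Z r)) p v =
    induced_metric c f M p (pullback_derivative c f M v Y p) (Z p)
       + induced_metric c f M p (Y p) (pullback_derivative c f M v Z p)"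
proof -
  obtain U \<phi> where "surface_chart c I f M U \<phi> p" using chart_exists[OF assms(1)] .
  then interpret surface_chart c I f M U \<phi> p .
  obtain a where v: "v = dF a" using assms(2) by (auto simp: tangent_plane_chart)
  show ?thesis
    unfolding v surface_deriv_chart[OF metric_differentiable[OF Y Z]]
    by (rule fun_cong[OF frechet_derivative_at[OF metric_has_derivative_chart[OF Y Z]], symmetric])
qed

lemma pullback_derivative_metric_constant:
  assumes "p \<in> pts M" "v \<in> tangent_plane M p"
    and "differentiable_in_charts M p Y" "Y p \<in> warped_tangent c (imm M p)"
    and "differentiable_in_charts M p Z" "Z p \<in> warped_tangent c (imm M p)"
    and C: "\<And>r. r \<in> pts M \<Longrightarrow> induced_metric c f M r (Y r) (Z r) = C"
  shows "induced_metric c f M p (pullback_derivative c f M v Y p) (Z p)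
       = - induced_metric c f M p (Y p) (pullback_derivative c f M v Z p)"
proof -
  obtain U \<phi> where "surface_chart c I f M U \<phi> p" using chart_exists[OF assms(1)] .
  then interpret surface_chart c I f M U \<phi> p .
  obtain a where v: "v = dF a" using assms(2) by (auto simp: tangent_plane_chart)
  have "((\<lambda>r. induced_metric c f M r (Y r) (Z r)) \<circ> E) r = C" if "r \<in> \<phi> ` U" for r
    using C[of "E r"] E_in[of r UNIV] that openin_subset[OF openin_chart] by auto
  from has_derivative_zero_on_open[OF metric_has_derivative_chart[OF assms(3-6)] open_chart P_in this]
  show ?thesis by (simp add: v eq_neg_iff_add_eq_0)
qed

end

section \<open>The connection along an immersed surface\<close>

context immersed_surface
begin

lemma tangent_field_differentiable:
  "tangent_field M W X \<Longrightarrow> p \<in> W \<Longrightarrow> differentiable_in_charts M p X"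
  unfolding tangent_field_def by (blast intro: surface_smooth_on_imp_differentiable)

lemma normal_field_differentiable:
  "normal_field c f M \<xi> \<Longrightarrow> p \<in> pts M \<Longrightarrow> differentiable_in_charts M p \<xi>"
  unfolding normal_field_def by (blast intro: surface_smooth_on_imp_differentiable)

lemma tangent_plane_in_warped_tangent:
  assumes "p \<in> pts M" "v \<in> tangent_plane M p"
  shows "v \<in> warped_tangent c (imm M p)"
proof -
  obtain U \<phi> where "surface_chart c I f M U \<phi> p" using chart_exists[OF assms(1)] .
  then interpret surface_chart c I f M U \<phi> p .
  show ?thesis using tangent_plane_subset assms(2) by blast
qed

lemma subspace_tangent_plane:
  assumes "p \<in> pts M"
  shows "subspace (tangent_plane M p)"
proof -
  obtain U \<phi> where "surface_chart c I f M U \<phi> p" using chart_exists[OF assms(1)] .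
  then interpret surface_chart c I f M U \<phi> p .
  show ?thesis
    unfolding tangent_plane_chart using linear_dF by (intro linear_subspace_image) auto
qed

lemma pullback_derivative_in_warped_tangent:
  assumes "p \<in> pts M" "v \<in> tangent_plane M p" "openin (topo M) W" "p \<in> W"
    and Y: "differentiable_in_charts M p Y" "\<And>r. r \<in> W \<Longrightarrow> Y r \<in> warped_tangent c (imm M r)"
  shows "pullback_derivative c f M v Y p \<in> warped_tangent c (imm M p)"
proof -
  obtain U \<phi> where "surface_chart c I f M U \<phi> p" using chart_exists[OF assms(1)] .
  then interpret surface_chart c I f M U \<phi> p .
  obtain a where v: "v = dF a" using assms(2) by (auto simp: tangent_plane_chart)
  have N: "open (\<phi> ` (U \<inter> W))" "P \<in> \<phi> ` (U \<inter> W)"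
    using chart_openin[OF assms(3)] p assms(4) by auto
  have "frechet_derivative (Y \<circ> E) (at P) a + christoffel c f (imm M (E P)) (dF a) (Y (E P))
      \<in> warped_tangent c (imm M (E P))"
  proof (rule covariant_derivative_tangent_to_warped[OF c N dF_has_derivative _ has_derivative_in_chart[OF Y(1)]])
    show "imm M (E r) \<in> warped c I" if "r \<in> \<phi> ` (U \<inter> W)" for r
      using that by (intro imm_in_warped) auto
    show "Y (E r) \<in> warped_tangent c (imm M (E r))" if "r \<in> \<phi> ` (U \<inter> W)" for r
      using E_in[OF that] by (intro Y(2)) auto
  qed
  then show ?thesis by (simp add: v pullback_derivative_chart[OF Y(1)])
qed

text \<open>
  For any representation \<open>Y = \<Sum>i<n. y i *\<^sub>R (V i \<circ> F)\<close> near \<open>p\<close>, the product and chain rules turn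
  the sum in the definition into \<open>dY(v) + christoffel(v, Y)\<close>, which no longer mentions the
  representation. One representation exists: the coefficients of \<open>Y\<close> in the standard basis together with the
  tangential extensions of the basis vectors.
\<close>

proposition ambient_nabla_eq:
  assumes X: "p \<in> pts M" "X p \<in> tangent_plane M p"
    and Y: "surface_smooth_on M (pts M) Y" "\<And>r. r \<in> pts M \<Longrightarrow> Y r \<in> warped_tangent c (imm M r)"
  shows "ambient_nabla c I f M X Y p = pullback_derivative c f M (X p) Y p"
  unfolding ambient_nabla_def
proof (rule the_equality)
  obtain U \<phi> where "surface_chart c I f M U \<phi> p" using chart_exists[OF X(1)] .
  then interpret surface_chart c I f M U \<phi> p .
  obtain a where a: "X p = dF a" using X(2) by (auto simp: tangent_plane_chart)
  have dY: "differentiable_in_charts M p Y"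
    by (rule surface_smooth_on_imp_differentiable[OF Y(1) X(1)])
  have derivative: "(\<Sum>i<n. surface_deriv M (y i) p (X p) *\<^sub>R V i (imm M p)
          + y i p *\<^sub>R warped_nabla c I f (X p) (V i) (imm M p)) =
      pullback_derivative c f M (X p) Y p"
    if W: "openin (topo M) W" "p \<in> W"
      and yV: "\<forall>i<n. surface_smooth_on M W (y i) \<and> V i \<in> warped_fields c I (imm M p)"
      and sum: "\<forall>r\<in>W. Y r = (\<Sum>i<n. y i r *\<^sub>R V i (imm M r))"
    for W and n :: nat and y :: "nat \<Rightarrow> 'm \<Rightarrow> real" and V
  proof -
    let ?Dy = "\<lambda>i. frechet_derivative (y i \<circ> E) (at P)"
    let ?DV = "\<lambda>i. frechet_derivative (V i) (at (imm M p))"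
    have y: "differentiable_in_charts M p (y i)" if "i < n" for i
      by (rule surface_smooth_on_imp_differentiable[of _ W]) (use yV W that in auto)
    have "((\<lambda>r. \<Sum>i<n. y i (E r) *\<^sub>R V i (imm M (E r))) has_derivative
        (\<lambda>a. \<Sum>i<n. y i (E P) *\<^sub>R ?DV i (dF a) + ?Dy i a *\<^sub>R V i (imm M (E P)))) (at P)"
    proof (rule has_derivative_sum)
      fix i assume i: "i \<in> {..<n}"
      have "(V i has_derivative ?DV i) (at (imm M (E P)))"
        unfolding E_P by (rule warped_fields_differentiable[of _ c I]) (use yV i in auto)
      from has_derivative_scaleR[OF has_derivative_in_chart[OF y]
          has_derivative_compose[OF dF_has_derivative this]] i
      show "((\<lambda>r. y i (E r) *\<^sub>R V i (imm M (E r))) has_derivative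
          (\<lambda>a. y i (E P) *\<^sub>R ?DV i (dF a) + ?Dy i a *\<^sub>R V i (imm M (E P)))) (at P)"
        by auto
    qed
    moreover have "open (\<phi> ` (U \<inter> W))" "P \<in> \<phi> ` (U \<inter> W)"
      using chart_openin[OF W(1)] p W(2) by auto
    moreover have "(\<Sum>i<n. y i (E r) *\<^sub>R V i (imm M (E r))) = (Y \<circ> E) r" if "r \<in> \<phi> ` (U \<inter> W)" for r
      using E_in[OF that] sum by simp
    ultimately have "((Y \<circ> E) has_derivative
        (\<lambda>a. \<Sum>i<n. y i (E P) *\<^sub>R ?DV i (dF a) + ?Dy i a *\<^sub>R V i (imm M (E P)))) (at P)"
      by (rule has_derivative_transform_within_open)
    from fun_cong[OF frechet_derivative_at[OF this], of a]
    have D: "frechet_derivative (Y \<circ> E) (at P) a =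
        (\<Sum>i<n. y i p *\<^sub>R ?DV i (dF a) + ?Dy i a *\<^sub>R V i (imm M p))"
      by simp
    have "warped_nabla c I f (dF a) (V i) (imm M p) =
        ?DV i (dF a) + christoffel c f (imm M p) (dF a) (V i (imm M p))" if "i < n" for i
      using warped_nabla_eq[OF c _ _ open_chart P_in dF_has_derivative imm_in_warped, of f "V i" a]
        f_at yV that by simp
    moreover have "surface_deriv M (y i) p (dF a) = ?Dy i a" if "i < n" for i
      using surface_deriv_chart[OF y[OF that]] .
    ultimately have "(\<Sum>i<n. surface_deriv M (y i) p (X p) *\<^sub>R V i (imm M p)
          + y i p *\<^sub>R warped_nabla c I f (X p) (V i) (imm M p)) =
        (\<Sum>i<n. (y i p *\<^sub>R ?DV i (dF a) + ?Dy i a *\<^sub>R V i (imm M p))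
          + y i p *\<^sub>R christoffel c f (imm M p) (dF a) (V i (imm M p)))"
      unfolding a by (intro sum.cong) (auto simp: algebra_simps)
    also have "\<dots> = frechet_derivative (Y \<circ> E) (at P) a
        + christoffel c f (imm M p) (dF a) (\<Sum>i<n. y i p *\<^sub>R V i (imm M p))"
      unfolding D sum.distrib[of "\<lambda>i. _ i + _ i"]
      by (simp add: linear_sum[OF linear_christoffel] christoffel_linear)
    also have "(\<Sum>i<n. y i p *\<^sub>R V i (imm M p)) = Y p"
      using sum W(2) by simp
    finally show ?thesis
      by (simp only: a pullback_derivative_chart[OF dY])
  qed
  define n where "n = card (Basis :: ambient set)"
  obtain b :: "nat \<Rightarrow> ambient" where b: "bij_betw b {..<n} Basis"
    using ex_bij_betw_nat_finite[of "Basis :: ambient set", folded n_def]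
    by (auto simp: atLeast0LessThan)
  define y where "y i r = Y r \<bullet> b i" for i r
  define V where "V i = tangential_extension c (b i)" for i
  have y: "surface_smooth_on M (pts M) (y i)" for i
    unfolding surface_smooth_on_def
  proof clarify
    fix U \<phi> assume U: "(U, \<phi>) \<in> charts M"
    have "openin (topo M) U" "open (\<phi> ` U)"
      using M(1) U unfolding smooth_2_manifold_def by blast+
    then have "open (\<phi> ` (U \<inter> pts M))"
      using openin_subset by (metis Int_absorb2)
    moreover have "smooth_on (\<phi> ` (U \<inter> pts M)) (Y \<circ> inv_into U \<phi>)"
      using Y(1) U unfolding surface_smooth_on_def by blast
    ultimately show "smooth_on (\<phi> ` (U \<inter> pts M)) (y i \<circ> inv_into U \<phi>)"
      using smooth_on_bounded_linear[OF _ bounded_linear_inner_left, of _ "Y \<circ> inv_into U \<phi>" "b i"]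
      by (simp add: y_def o_def)
  qed
  have V: "V i \<in> warped_fields c I (imm M p)" for i
    unfolding V_def by (rule tangential_extension_in_warped_fields[OF c])
  have sum: "Y r = (\<Sum>i<n. y i r *\<^sub>R V i (imm M r))" if "r \<in> pts M" for r
  proof -
    have "(\<Sum>i<n. y i r *\<^sub>R V i (imm M r)) = tangential_extension c (\<Sum>i<n. (Y r \<bullet> b i) *\<^sub>R b i) (imm M r)"
      by (simp add: linear_sum[OF linear_tangential_extension] y_def V_def
          linear_cmul[OF linear_tangential_extension])
    also have "(\<Sum>i<n. (Y r \<bullet> b i) *\<^sub>R b i) = (\<Sum>e\<in>Basis. (Y r \<bullet> e) *\<^sub>R e)"
      using sum.reindex_bij_betw[OF b, of "\<lambda>e. (Y r \<bullet> e) *\<^sub>R e"] by simp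
    also have "\<dots> = Y r" by (rule euclidean_representation)
    finally show ?thesis using tangential_extension_eq[OF Y(2)[OF that]] by simp
  qed
  show "\<exists>W (n::nat) y V. openin (topo M) W \<and> p \<in> W \<and>
      (\<forall>i<n. surface_smooth_on M W (y i) \<and> V i \<in> warped_fields c I (imm M p)) \<and>
      (\<forall>r\<in>W. Y r = (\<Sum>i<n. y i r *\<^sub>R V i (imm M r))) \<and>
      pullback_derivative c f M (X p) Y p =
        (\<Sum>i<n. surface_deriv M (y i) p (X p) *\<^sub>R V i (imm M p)
          + y i p *\<^sub>R warped_nabla c I f (X p) (V i) (imm M p))"
  proof (rule exI[of _ "pts M"], rule exI[of _ n], rule exI[of _ y], rule exI[of _ V], intro conjI)
    show "openin (topo M) (pts M)" "p \<in> pts M" using X(1) by auto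
    show yV: "\<forall>i<n. surface_smooth_on M (pts M) (y i) \<and> V i \<in> warped_fields c I (imm M p)"
      using y V by blast
    show Y_sum: "\<forall>r\<in>pts M. Y r = (\<Sum>i<n. y i r *\<^sub>R V i (imm M r))"
      using sum by blast
    show "pullback_derivative c f M (X p) Y p =
        (\<Sum>i<n. surface_deriv M (y i) p (X p) *\<^sub>R V i (imm M p)
          + y i p *\<^sub>R warped_nabla c I f (X p) (V i) (imm M p))"
      by (rule derivative[OF openin_topspace X(1) yV Y_sum, symmetric])
  qed
  show "w = pullback_derivative c f M (X p) Y p"
    if "\<exists>W (n::nat) y V. openin (topo M) W \<and> p \<in> W \<and>
      (\<forall>i<n. surface_smooth_on M W (y i) \<and> V i \<in> warped_fields c I (imm M p)) \<and>
      (\<forall>r\<in>W. Y r = (\<Sum>i<n. y i r *\<^sub>R V i (imm M r))) \<and>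
      w = (\<Sum>i<n. surface_deriv M (y i) p (X p) *\<^sub>R V i (imm M p)
          + y i p *\<^sub>R warped_nabla c I f (X p) (V i) (imm M p))" for w
    using that by (elim exE conjE) (erule trans, rule derivative)
qed

text \<open>
  The sum \<open>A + B\<close> is constant as a map into \<open>\<real>\<^sup>4 \<times> \<real>\<close>, so only the term \<open>christoffel\<close> remains.
\<close>

lemma pullback_derivative_d_dz:
  assumes "p \<in> pts M" "v \<in> tangent_plane M p"
    and A: "differentiable_in_charts M p A" and B: "differentiable_in_charts M p B"
    and sum: "\<And>r. r \<in> pts M \<Longrightarrow> d_dz = A r + B r"
  shows "pullback_derivative c f M v A p + pullback_derivative c f M v B p =
    (deriv f (snd (imm M p)) / f (snd (imm M p))) *\<^sub>R (v - snd v *\<^sub>R d_dz)"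
proof -
  obtain U \<phi> where "surface_chart c I f M U \<phi> p" using chart_exists[OF assms(1)] .
  then interpret surface_chart c I f M U \<phi> p .
  obtain a where v: "v = dF a" using assms(2) by (auto simp: tangent_plane_chart)
  have "A (E r) + B (E r) = d_dz" if "r \<in> \<phi> ` U" for r
    using sum[of "E r"] E_in[of r UNIV] that openin_subset[OF openin_chart] by auto
  from has_derivative_zero_on_open[OF has_derivative_add[OF has_derivative_in_chart[OF A]
      has_derivative_in_chart[OF B]] open_chart P_in this]
  have "frechet_derivative (A \<circ> E) (at P) a + frechet_derivative (B \<circ> E) (at P) a = 0" .
  then have "pullback_derivative c f M v A p + pullback_derivative c f M v B p =
      christoffel c f (imm M p) v (A p + B p)"
    by (simp add: v pullback_derivative_chart[OF A] pullback_derivative_chart[OF B]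
        christoffel_linear algebra_simps)
  then show ?thesis
    using sum[OF assms(1)] by (metis christoffel_d_dz)
qed

text \<open>
  Symmetry of the second fundamental form. Differentiating \<open>\<langle>Y, \<xi>\<rangle> = 0\<close> shows that
  \<open>\<langle>D\<^sub>X Y, \<xi>\<rangle>\<close> depends only on the value of \<open>Y\<close> at \<open>p\<close>, so \<open>Y\<close> may be replaced by the
  coordinate field with the same value there. For coordinate fields the claim is the symmetry of the second
  derivative of the immersion.
\<close>

lemma pullback_derivative_symmetric:
  assumes "p \<in> pts M" and X: "tangent_field M (pts M) X" and Y: "tangent_field M (pts M) Y"
    and \<xi>: "normal_field c f M \<xi>"
  shows "induced_metric c f M p (pullback_derivative c f M (X p) Y p) (\<xi> p) =
    induced_metric c f M p (pullback_derivative c f M (Y p) X p) (\<xi> p)"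
proof -
  obtain U \<phi> where "surface_chart c I f M U \<phi> p" using chart_exists[OF assms(1)] .
  then interpret surface_chart c I f M U \<phi> p .
  let ?F = "imm M \<circ> E"
  let ?G = "warped_metric c f (imm M p)"
  define F2 where "F2 b = frechet_derivative (\<lambda>r. frechet_derivative ?F (at r) b) (at P)" for b
  have smooth: "smooth_on (\<phi> ` U) ?F"
    using M(2) chart openin_subset[OF openin_chart]
    unfolding immersed_in_warped_def surface_smooth_on_def by (metis (no_types, lifting) case_prodD Int_absorb2)
  have d\<xi>: "differentiable_in_charts M p \<xi>" and t\<xi>: "\<xi> p \<in> warped_tangent c (imm M p)"
    using \<xi> assms(1) normal_field_differentiable by (auto simp: normal_field_def)
  have orthogonal: "warped_metric c f (imm M r) v (\<xi> r) = 0"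
    if "r \<in> pts M" "v \<in> tangent_plane M r" for r v
    using \<xi> that warped_metric_commute[of c f "imm M r" v]
    by (simp add: normal_field_def induced_metric_def)
  have normal: "?G (pullback_derivative c f M (dF a) Z p) (\<xi> p) =
      ?G (F2 b a + christoffel c f (imm M p) (dF a) (dF b)) (\<xi> p)"
    if Z: "tangent_field M (pts M) Z" and b: "Z p = dF b" for Z a b
  proof -
    have dZ: "differentiable_in_charts M p Z" and tZ: "Z p \<in> warped_tangent c (imm M p)"
      using Z assms(1) tangent_field_differentiable tangent_plane_in_warped_tangent
      by (auto simp: tangent_field_def)
    have "?G (pullback_derivative c f M (dF a) Z p) (\<xi> p) =
        - ?G (Z p) (pullback_derivative c f M (dF a) \<xi> p)"
    proof (rule pullback_derivative_metric_constant[unfolded induced_metric_def, where C = 0])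
      show "dF a \<in> tangent_plane M p" by (simp add: tangent_plane_chart)
      show "warped_metric c f (imm M r) (Z r) (\<xi> r) = 0" if "r \<in> pts M" for r
        using orthogonal Z that by (simp add: tangent_field_def)
    qed (use assms(1) dZ tZ d\<xi> t\<xi> in auto)
    moreover have "?G (F2 b a + christoffel c f (imm M p) (dF a) (dF b)) (\<xi> p) +
        ?G (dF b) (frechet_derivative (\<xi> \<circ> E) (at P) a + christoffel c f (imm M p) (dF a) (\<xi> p)) = 0"
    proof -
      have "((\<lambda>r. frechet_derivative ?F (at r) b) has_derivative F2 b) (at P)"
        unfolding F2_def frechet_derivative_works[symmetric]
        by (rule smooth_on_differentiable[OF smooth_on_frechet_derivative[OF smooth] P_in])
      note D = warped_metric_has_derivative[OF dF_has_derivative this has_derivative_in_chart[OF d\<xi>], of f c]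
      have "warped_metric c f (imm M (E r)) (frechet_derivative ?F (at r) b) (\<xi> (E r)) = 0"
        if "r \<in> \<phi> ` U" for r
      proof -
        have r: "E r \<in> U" "\<phi> (E r) = r" using E_in[of r UNIV] \<phi>_E[of r UNIV] that by auto
        then have "E r \<in> pts M" using openin_subset[OF openin_chart] by auto
        moreover have "frechet_derivative ?F (at r) b \<in> tangent_plane M (E r)"
          unfolding tangent_plane_def using chart r by (intro CollectI bexI[of _ "(U, \<phi>)"]) auto
        ultimately show ?thesis
          by (rule orthogonal)
      qed
      from has_derivative_zero_on_open[OF D open_chart P_in this]
      show ?thesis
        using f_at warped_tangent_orthogonal[OF t\<xi>] warped_tangent_orthogonal[OF tZ]
        by (simp add: b)
    qed
    ultimately show ?thesis
      by (simp add: b pullback_derivative_chart[OF d\<xi>])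
  qed
  have "X p \<in> range dF" "Y p \<in> range dF"
    using X Y assms(1) by (auto simp: tangent_field_def simp flip: tangent_plane_chart)
  then obtain a b where ab: "X p = dF a" "Y p = dF b" by blast
  have "F2 a b = F2 b a"
    unfolding F2_def by (rule symmetric_second_derivative[OF open_chart P_in smooth])
  then show ?thesis
    using normal[OF Y ab(2), of a] normal[OF X ab(1), of b] ab
      christoffel_commute[of c f "imm M p" "dF a" "dF b"]
    by (simp add: induced_metric_def)
qed

end

section \<open>Null frames\<close>

locale null_frame = immersed_surface c I f M
  for c :: real and I :: "real set" and f :: "real \<Rightarrow> real" and M :: "'m surface" +
  fixes T U :: "'m \<Rightarrow> ambient"
  assumes T: "tangent_field M (pts M) T" and U: "tangent_field M (pts M) U"
    and null: "\<And>p. p \<in> pts M \<Longrightarrow> induced_metric c f M p (T p) (T p) = 0"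
      "\<And>p. p \<in> pts M \<Longrightarrow> induced_metric c f M p (U p) (U p) = 0"
      "\<And>p. p \<in> pts M \<Longrightarrow> induced_metric c f M p (T p) (U p) = -1"
begin

abbreviation g :: "'m \<Rightarrow> ambient \<Rightarrow> ambient \<Rightarrow> real" where "g \<equiv> induced_metric c f M"

text \<open>
  The orthogonal projection to the tangent plane. The coefficients look interchanged because \<open>T\<close>
  and \<open>U\<close> are null vectors with product \<open>-1\<close>.
\<close>

definition proj :: "'m \<Rightarrow> ambient \<Rightarrow> ambient" where
  "proj p w = - g p w (U p) *\<^sub>R T p - g p w (T p) *\<^sub>R U p"

lemma g_commute: "g p v w = g p w v"
  by (simp add: induced_metric_def warped_metric_commute)

lemma g_linear [simp]:
  "g p (u + v) w = g p u w + g p v w" "g p w (u + v) = g p w u + g p w v"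
  "g p (u - v) w = g p u w - g p v w" "g p w (u - v) = g p w u - g p w v"
  "g p (- u) w = - g p u w" "g p w (- u) = - g p w u"
  "g p (a *\<^sub>R u) w = a * g p u w" "g p w (a *\<^sub>R u) = a * g p w u"
  "g p 0 w = 0" "g p w 0 = 0"
  by (simp_all add: induced_metric_def)

lemma frame_tangent: "p \<in> pts M \<Longrightarrow> T p \<in> tangent_plane M p" "p \<in> pts M \<Longrightarrow> U p \<in> tangent_plane M p"
  using T U by (auto simp: tangent_field_def)

lemma null_UT: "p \<in> pts M \<Longrightarrow> g p (U p) (T p) = -1"
  using null(3) g_commute by metis

lemma proj_tangent: "p \<in> pts M \<Longrightarrow> proj p w \<in> tangent_plane M p"
  unfolding proj_def
  by (intro subspace_diff subspace_scale subspace_tangent_plane frame_tangent)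

text \<open>
  Two null vectors with non-zero product are linearly independent, so \<open>T\<close> and \<open>U\<close> span the tangent
  plane, which is two-dimensional.
\<close>

lemma proj_eq:
  assumes pM: "p \<in> pts M" and v: "v \<in> tangent_plane M p"
  shows "proj p v = v"
proof -
  obtain V \<phi> where "surface_chart c I f M V \<phi> p" using chart_exists[OF pM] .
  then interpret surface_chart c I f M V \<phi> p .
  obtain a b where ab: "T p = dF a" "U p = dF b"
    using frame_tangent[OF pM] by (auto simp: tangent_plane_chart)
  define K :: "real^2 \<Rightarrow> real^2" where "K x = x $ 1 *\<^sub>R a + x $ 2 *\<^sub>R b" for x
  have K: "linear K" by (rule linearI) (simp_all add: K_def algebra_simps)
  have dFK: "dF (K x) = x $ 1 *\<^sub>R T p + x $ 2 *\<^sub>R U p" for x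
    by (simp add: K_def ab linear_add[OF linear_dF] linear_cmul[OF linear_dF])
  have "x = 0" if "K x = 0" for x
  proof -
    have zero: "x $ 1 *\<^sub>R T p + x $ 2 *\<^sub>R U p = 0"
      using dFK[of x] that linear_0[OF linear_dF] by simp
    have "g p (x $ 1 *\<^sub>R T p + x $ 2 *\<^sub>R U p) (U p) = 0" "g p (x $ 1 *\<^sub>R T p + x $ 2 *\<^sub>R U p) (T p) = 0"
      unfolding zero by simp_all
    then show ?thesis
      using null[OF pM] null_UT[OF pM] by (simp add: vec_eq_iff forall_2)
  qed
  then have surj: "surj K"
    using linear_injective_imp_surjective[OF K] linear_injective_0[OF K] by blast
  obtain d where "v = dF d" using v by (auto simp: tangent_plane_chart)
  moreover obtain x where "d = K x" using surj by (rule surjE)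
  ultimately have "v = x $ 1 *\<^sub>R T p + x $ 2 *\<^sub>R U p" by (simp only: dFK)
  then show ?thesis
    using null[OF pM] null_UT[OF pM] by (simp add: proj_def)
qed

lemma g_proj:
  assumes "p \<in> pts M" "v \<in> tangent_plane M p"
  shows "g p (proj p w) v = g p w v"
proof -
  have "g p (proj p w) (proj p v) = g p w (proj p v)"
    using null[OF assms(1)] null_UT[OF assms(1)] by (simp add: proj_def)
  then show ?thesis using proj_eq[OF assms] by simp
qed

lemma tangential_part_eq:
  assumes p: "p \<in> pts M"
  shows "tangential_part c f M p w = proj p w"
  unfolding tangential_part_def
proof (rule the_equality)
  show "proj p w \<in> tangent_plane M p \<and> (\<forall>u\<in>tangent_plane M p. g p (w - proj p w) u = 0)"
    using proj_tangent g_proj p by simp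
next
  fix t assume t: "t \<in> tangent_plane M p \<and> (\<forall>u\<in>tangent_plane M p. g p (w - t) u = 0)"
  then have "proj p t = proj p w"
    using frame_tangent[OF p] by (simp add: proj_def)
  then show "t = proj p w" using proj_eq p t by simp
qed

text \<open>
  The unprojected derivative satisfies the Koszul formula on tangent fields, as it is metric and its torsion
  vanishes by the very definition of the bracket. Projection does not change products with tangent
  vectors. Uniqueness is tested on the global fields \<open>T\<close> and \<open>U\<close>.
\<close>

proposition surface_nabla_eq:
  assumes p: "p \<in> pts M" and X: "tangent_field M (pts M) X" and Y: "tangent_field M (pts M) Y"
  shows "surface_nabla c f M X Y p = proj p (pullback_derivative c f M (X p) Y p)"
  unfolding surface_nabla_def
proof (rule levi_civita_eqI[where ?X0.0 = X])
  have pts_fields: "A \<in> local_tangent_fields M p" if "tangent_field M (pts M) A" for A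
    unfolding local_tangent_fields_def using that p by blast
  show "X \<in> local_tangent_fields M p" "X p = X p" using X pts_fields by auto
  show "proj p (pullback_derivative c f M (X p) Y p) \<in> tangent_plane M p"
    by (rule proj_tangent[OF p])
  have tangent: "A p \<in> tangent_plane M p" if "A \<in> local_tangent_fields M p" for A
    using that by (auto simp: local_tangent_fields_def tangent_field_def)
  have compat: "surface_deriv M (\<lambda>r. g r (A r) (B r)) p (C p) =
      g p (pullback_derivative c f M (C p) A p) (B p) + g p (A p) (pullback_derivative c f M (C p) B p)"
    if "A \<in> local_tangent_fields M p" "B \<in> local_tangent_fields M p" "C \<in> local_tangent_fields M p"
    for A B C
  proof -
    have "differentiable_in_charts M p A" "differentiable_in_charts M p B"
      using that tangent_field_differentiable unfolding local_tangent_fields_def by blast+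
    then show ?thesis
      using pullback_derivative_metric[OF p tangent[OF that(3)]] tangent_plane_in_warped_tangent[OF p]
        tangent that by blast
  qed
  show "2 * g p (proj p (pullback_derivative c f M (X p) Y p)) (Z p) =
      koszul (surface_deriv M) (surface_bracket M) g X' Y Z p"
    if "X' \<in> local_tangent_fields M p" "Z \<in> local_tangent_fields M p" "X' p = X p" for X' Z
  proof -
    note fields = that(1,2) pts_fields[OF Y]
    have "koszul (surface_deriv M) (surface_bracket M) g X' Y Z p =
        2 * g p (pullback_derivative c f M (X' p) Y p) (Z p)"
    proof (rule koszul_metric_torsion_free[where n = "\<lambda>A B. pullback_derivative c f M (A p) B p"])
      show "surface_bracket M A B p = pullback_derivative c f M (A p) B p
          - pullback_derivative c f M (B p) A p" for A B
        using christoffel_commute[of c f "imm M p" "A p" "B p"]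
        by (simp add: surface_bracket_def pullback_derivative_def)
    qed (rule compat fields g_linear(3) g_commute)+
    then show ?thesis using g_proj[OF p tangent[OF that(2)]] that(3) by simp
  qed
  show "u = proj p (pullback_derivative c f M (X p) Y p)"
    if "u \<in> tangent_plane M p"
      "\<And>Z. Z \<in> local_tangent_fields M p \<Longrightarrow>
        g p u (Z p) = g p (proj p (pullback_derivative c f M (X p) Y p)) (Z p)" for u
  proof -
    let ?w = "proj p (pullback_derivative c f M (X p) Y p)"
    have "proj p u = proj p ?w"
      using that(2)[OF pts_fields[OF T]] that(2)[OF pts_fields[OF U]] by (simp add: proj_def)
    then show ?thesis using proj_eq[OF p] that(1) proj_tangent[OF p] by simp
  qed
qed

end

section \<open>Positively oriented frames\<close>

lemma exhaust_5:
  fixes x :: 5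
  shows "x = 1 \<or> x = 2 \<or> x = 3 \<or> x = 4 \<or> x = 5"
proof (induct x)
  case (of_int z)
  then have "z = 0 \<or> z = 1 \<or> z = 2 \<or> z = 3 \<or> z = 4" by fastforce
  then show ?case by auto
qed

lemma forall_5: "(\<forall>i::5. P i) \<longleftrightarrow> P 1 \<and> P 2 \<and> P 3 \<and> P 4 \<and> P 5"
  by (metis exhaust_5)

lemma UNIV_5: "UNIV = {1, 2, 3, 4, 5 :: 5}"
  using exhaust_5 by auto

lemma sum_5: "sum f (UNIV::5 set) = f 1 + f 2 + f 3 + f 4 + f 5"
  unfolding UNIV_5 by (simp add: ac_simps)

lemma vector_5 [simp]:
  "(vector [a, b, c, d, e] :: 'a::zero^5) $ 1 = a"
  "(vector [a, b, c, d, e] :: 'a::zero^5) $ 2 = b"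
  "(vector [a, b, c, d, e] :: 'a::zero^5) $ 3 = c"
  "(vector [a, b, c, d, e] :: 'a::zero^5) $ 4 = d"
  "(vector [a, b, c, d, e] :: 'a::zero^5) $ 5 = e"
  by (simp_all add: vector_def)

text \<open>
  The rows of the determinant in \<open>positive_frame\<close> are linearly independent. The metric product with \<open>w\<close> is a
  linear functional on \<open>\<real>\<^sup>5\<close> that vanishes on all of them, the first row being orthogonal
  to every tangent vector of the warped product.
\<close>

lemma orthogonal_to_positive_frame:
  assumes frame: "positive_frame c s q v1 v2 v3 v4" and f: "f (snd q) \<noteq> 0"
    and w: "w \<in> warped_tangent c q"
    and orth: "\<And>v. v \<in> {v1, v2, v3, v4} \<Longrightarrow> warped_metric c f q v w = 0"
  shows "w = 0"
proof -
  define A :: "real^5^5" where "A = vector [to_real5 (if c = 0 then axis 4 1 else fst q, 0),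
       to_real5 v1, to_real5 v2, to_real5 v3, to_real5 v4]"
  \<comment> \<open>The coefficient vector of the functional \<open>v \<mapsto> warped_metric c f q v w\<close>.\<close>
  define b :: "real^5" where "b = vector [- (f (snd q))\<^sup>2 * fst w $ 1, (f (snd q))\<^sup>2 * fst w $ 2,
      (f (snd q))\<^sup>2 * fst w $ 3, (f (snd q))\<^sup>2 * (if c < 0 then -1 else 1) * fst w $ 4, snd w]"
  have row: "(\<Sum>j\<in>UNIV. to_real5 v $ j * b $ j) = warped_metric c f q v w" for v
    by (simp add: sum_5 to_real5_def b_def warped_metric_def flat_form_def algebra_simps)
  have "warped_metric c f q (if c = 0 then axis 4 1 else fst q, 0) w = 0"
    using w by (auto simp: warped_metric_def warped_tangent_def space_form_tangent_def
        flat_form_def axis_def mem_Times_iff)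
  then have "A *v b = 0"
    using orth by (simp add: vec_eq_iff forall_5 matrix_vector_mult_def A_def row)
  moreover have "det A \<noteq> 0"
    using frame unfolding positive_frame_def A_def[symmetric] by auto
  then have "invertible A" by (simp add: invertible_det_nz)
  ultimately have "b = 0"
    by (metis invertible_def matrix_left_invertible_ker)
  then have "\<forall>i. b $ i = 0" by simp
  then show ?thesis
    using f by (auto simp: forall_5 b_def prod_eq_iff vec_eq_iff forall_4 split: if_splits)
qed

section \<open>Surfaces with light-like tangential part of the vertical field\<close>

locale adapted_frame = null_frame c I f M T U
  for c :: real and I :: "real set" and f :: "real \<Rightarrow> real" and M :: "'m surface"
    and T U :: "'m \<Rightarrow> ambient" +
  fixes e3 e4 :: "'m \<Rightarrow> ambient" and s :: real
  assumes e3: "normal_field c f M e3" and e4: "normal_field c f M e4"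
    and decomposition: "\<And>p. p \<in> pts M \<Longrightarrow> d_dz = T p + e3 p"
    and e4_unit: "\<And>p. p \<in> pts M \<Longrightarrow> induced_metric c f M p (e4 p) (e4 p) = 1"
    and e3_e4: "\<And>p. p \<in> pts M \<Longrightarrow> induced_metric c f M p (e3 p) (e4 p) = 0"
    and positive: "\<And>p. p \<in> pts M \<Longrightarrow> positive_frame c s (imm M p) (T p) (U p) (e3 p) (e4 p)"
begin

abbreviation D :: "('m \<Rightarrow> ambient) \<Rightarrow> ('m \<Rightarrow> ambient) \<Rightarrow> 'm \<Rightarrow> ambient" where
  "D X Y p \<equiv> pullback_derivative c f M (X p) Y p"

abbreviation k :: "'m \<Rightarrow> real" where
  "k p \<equiv> deriv f (snd (imm M p)) / f (snd (imm M p))"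

lemma normal_tangent:
  assumes "p \<in> pts M" "\<xi> \<in> {e3, e4}" "X \<in> {T, U}"
  shows "g p (\<xi> p) (X p) = 0" "g p (X p) (\<xi> p) = 0"
proof -
  show "g p (\<xi> p) (X p) = 0"
    using assms e3 e4 frame_tangent[OF assms(1)] by (auto simp: normal_field_def)
  then show "g p (X p) (\<xi> p) = 0" by (simp add: g_commute)
qed

lemma e3_unit:
  assumes "p \<in> pts M"
  shows "g p (e3 p) (e3 p) = 1"
proof -
  have "g p (T p + e3 p) (T p + e3 p) = 1"
    unfolding decomposition[OF assms, symmetric]
    by (simp add: induced_metric_def) (simp add: d_dz_def)
  then show ?thesis
    using null(1)[OF assms] normal_tangent[OF assms, of e3 T] by simp
qed

lemma snd_frame:
  assumes "p \<in> pts M"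
  shows "snd (T p) = 0" "snd (U p) = -1"
proof -
  have snd: "snd v = g p v (T p + e3 p)" for v
    unfolding decomposition[OF assms, symmetric] by (simp add: induced_metric_def)
  show "snd (T p) = 0" "snd (U p) = -1"
    unfolding snd using null[OF assms] null_UT[OF assms] normal_tangent[OF assms, of e3]
    by simp_all
qed

lemma frame_field_regular:
  assumes "p \<in> pts M" "Y \<in> {T, U, e3, e4}"
  shows "differentiable_in_charts M p Y" "Y p \<in> warped_tangent c (imm M p)"
    "surface_smooth_on M (pts M) Y"
proof -
  have "surface_smooth_on M (pts M) T" "surface_smooth_on M (pts M) U"
    using T U by (simp_all add: tangent_field_def)
  moreover have "surface_smooth_on M (pts M) e3" "surface_smooth_on M (pts M) e4"
    using e3 e4 by (simp_all add: normal_field_def)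
  ultimately show smooth: "surface_smooth_on M (pts M) Y" using assms(2) by blast
  then show "differentiable_in_charts M p Y"
    using assms(1) by (rule surface_smooth_on_imp_differentiable)
  have "T p \<in> warped_tangent c (imm M p)" "U p \<in> warped_tangent c (imm M p)"
    using assms(1) by (simp_all add: frame_tangent tangent_plane_in_warped_tangent)
  moreover have "e3 p \<in> warped_tangent c (imm M p)" "e4 p \<in> warped_tangent c (imm M p)"
    using e3 e4 assms(1) by (simp_all add: normal_field_def)
  ultimately show "Y p \<in> warped_tangent c (imm M p)" using assms(2) by blast
qed

lemma D_vertical:
  assumes "p \<in> pts M"
  shows "D T e3 p = k p *\<^sub>R T p - D T T p"
    "D U e3 p = k p *\<^sub>R (U p + T p + e3 p) - D U T p"
proof -
  have "D X T p + D X e3 p = k p *\<^sub>R (X p - snd (X p) *\<^sub>R d_dz)" if "X \<in> {T, U}" for X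
    using that assms frame_tangent frame_field_regular decomposition
    by (intro pullback_derivative_d_dz) auto
  from this[of T] this[of U, unfolded decomposition[OF assms]] show "D T e3 p = k p *\<^sub>R T p - D T T p"
    "D U e3 p = k p *\<^sub>R (U p + T p + e3 p) - D U T p"
    using snd_frame[OF assms] by (simp_all add: algebra_simps)
qed

lemma D_skew:
  assumes "p \<in> pts M" "X \<in> {T, U}" "Y \<in> {T, U, e3, e4}" "Z \<in> {T, U, e3, e4}"
  shows "g p (D X Y p) (Z p) = - g p (D X Z p) (Y p)"
proof -
  have "\<exists>C. \<forall>r\<in>pts M. g r (Y r) (Z r) = C"
    using assms(3,4) e3_e4 g_commute
    by (elim insertE emptyE) (auto simp: null null_UT normal_tangent e3_unit e4_unit)
  then obtain C where C: "\<And>r. r \<in> pts M \<Longrightarrow> g r (Y r) (Z r) = C" by blast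
  have "X p \<in> tangent_plane M p" using assms(1,2) frame_tangent by auto
  from pullback_derivative_metric_constant[OF assms(1) this frame_field_regular(1,2)[OF assms(1,3)]
      frame_field_regular(1,2)[OF assms(1,4)] C]
  show ?thesis by (simp add: g_commute)
qed

lemma ambient_nabla_frame:
  assumes "p \<in> pts M" "X \<in> {T, U}" "Y \<in> {T, U, e3, e4}"
  shows "ambient_nabla c I f M X Y p = D X Y p"
  using assms frame_tangent frame_field_regular by (intro ambient_nabla_eq) auto

lemma surface_nabla_frame:
  assumes "p \<in> pts M" "X \<in> {T, U}" "Y \<in> {T, U}"
  shows "surface_nabla c f M X Y p = proj p (D X Y p)"
  using assms T U by (intro surface_nabla_eq) auto

text \<open>
  The two sides have the same products with \<open>e3\<close> and \<open>e4\<close> by the symmetry of the second fundamental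
  form. A vector normal to the surface is determined by these products since the
  frame, being positively oriented, is linearly independent.
\<close>

lemma normal_part_symmetric:
  assumes p: "p \<in> pts M"
  shows "D U T p - proj p (D U T p) = D T U p - proj p (D T U p)"
proof -
  let ?B = "(D U T p - proj p (D U T p)) - (D T U p - proj p (D T U p))"
  obtain V \<phi> where "surface_chart c I f M V \<phi> p" using chart_exists[OF p] .
  then have f0: "f (snd (imm M p)) \<noteq> 0" by (rule surface_chart.f_at)
  have "?B = 0"
  proof (rule orthogonal_to_positive_frame[of c s "imm M p" "T p" "U p" "e3 p" "e4 p" f,
        OF positive[OF p] f0])
    have "D X Y p \<in> warped_tangent c (imm M p)" if "X \<in> {T, U}" "Y \<in> {T, U}" for X Y
      using that p frame_tangent frame_field_regular
      by (intro pullback_derivative_in_warped_tangent[of _ _ "pts M"]) auto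
    then show "?B \<in> warped_tangent c (imm M p)"
      using tangent_plane_in_warped_tangent[OF p proj_tangent[OF p]]
      by (intro warped_tangent_linear) auto
    have "g p ?B (X p) = 0" if "X \<in> {T, U}" for X
    proof -
      have "X p \<in> tangent_plane M p" using that frame_tangent[OF p] by blast
      then show ?thesis by (simp add: g_proj[OF p])
    qed
    moreover have "g p ?B (\<xi> p) = 0" if \<xi>: "\<xi> \<in> {e3, e4}" for \<xi>
    proof -
      have "normal_field c f M \<xi>" using \<xi> e3 e4 by auto
      then have "g p (D T U p) (\<xi> p) = g p (D U T p) (\<xi> p)"
        using pullback_derivative_symmetric[OF p T U] by blast
      moreover have "g p (proj p w) (\<xi> p) = 0" for w
        using normal_tangent[OF p \<xi>] by (simp add: proj_def)
      ultimately show ?thesis by simp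
    qed
    ultimately have "g p (X p) ?B = 0" if "X \<in> {T, U, e3, e4}" for X
      using that g_commute[of p "X p"] by auto
    then show "warped_metric c f (imm M p) v ?B = 0" if "v \<in> {T p, U p, e3 p, e4 p}" for v
      using that by (auto simp only: induced_metric_def insert_iff empty_iff)
  qed
  then show ?thesis by simp
qed

lemma second_fundamental_form_frame:
  assumes "p \<in> pts M" "X \<in> {T, U}" "Y \<in> {T, U}"
  shows "second_fundamental_form c I f M X Y p = D X Y p - proj p (D X Y p)"
  using assms surface_nabla_frame ambient_nabla_frame[of p X Y]
  by (auto simp: second_fundamental_form_def)

lemma proj_simps:
  "proj p (v + w) = proj p v + proj p w" "proj p (v - w) = proj p v - proj p w"
  "proj p (a *\<^sub>R v) = a *\<^sub>R proj p v"
  "p \<in> pts M \<Longrightarrow> proj p (T p) = T p" "p \<in> pts M \<Longrightarrow> proj p (U p) = U p"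
  "p \<in> pts M \<Longrightarrow> proj p (e3 p) = 0"
  using frame_tangent normal_tangent
  by (simp_all add: proj_eq) (simp_all add: proj_def algebra_simps)

lemma normal_coordinates:
  assumes p: "p \<in> pts M" and w: "w - proj p w = a *\<^sub>R e3 p + b *\<^sub>R e4 p"
  shows "g p w (e3 p) = a" "g p w (e4 p) = b"
proof -
  have "g p w \<xi> = g p (a *\<^sub>R e3 p + b *\<^sub>R e4 p) \<xi>" if "\<xi> \<in> {e3 p, e4 p}" for \<xi>
    using that normal_tangent[OF p] by (auto simp flip: w simp: proj_def)
  then show "g p w (e3 p) = a" "g p w (e4 p) = b"
    using e3_unit[OF p] e4_unit[OF p] e3_e4[OF p] g_commute[of p "e4 p" "e3 p"] by simp_all
qed

lemma shape_operator_frame: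
  assumes "p \<in> pts M" "X \<in> {T, U}" "\<xi> \<in> {e3, e4}"
  shows "shape_operator c I f M \<xi> X p =
    - g p (D X U p) (\<xi> p) *\<^sub>R T p - g p (D X T p) (\<xi> p) *\<^sub>R U p"
  using assms D_skew[OF assms(1,2), of \<xi> U] D_skew[OF assms(1,2), of \<xi> T]
    ambient_nabla_frame[OF assms(1,2), of \<xi>]
  by (simp add: shape_operator_def tangential_part_eq) (simp add: proj_def)

lemma normal_nabla_e3:
  assumes p: "p \<in> pts M"
  shows "normal_nabla c I f M T e3 p = - second_fundamental_form c I f M T T p"
    "normal_nabla c I f M U e3 p = k p *\<^sub>R e3 p - second_fundamental_form c I f M T U p"
  using normal_part_symmetric[OF p]
  by (simp_all add: normal_nabla_def tangential_part_eq p ambient_nabla_frame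
      second_fundamental_form_frame D_vertical proj_simps algebra_simps)

text \<open>
  As \<open>e3\<close> is a unit field, \<open>D\<^sub>X e3\<close> has no \<open>e3\<close>-component; the \<open>e3\<close>-components of the equations in
  \<open>D_vertical\<close> therefore give the first value and the one for \<open>D\<^sub>U T\<close>, which symmetry carries over to
  \<open>D\<^sub>T U\<close>.
\<close>

lemma e3_components:
  assumes p: "p \<in> pts M"
  shows "g p (D T T p) (e3 p) = 0" "g p (D T U p) (e3 p) = k p"
proof -
  have unit: "g p (D X e3 p) (e3 p) = 0" if "X \<in> {T, U}" for X
    using D_skew[OF p that, of e3 e3] by simp
  show "g p (D T T p) (e3 p) = 0"
    using unit[of T] normal_tangent[OF p] by (simp add: D_vertical[OF p])
  have "g p (D U T p) (e3 p) = k p"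
    using unit[of U] normal_tangent[OF p] e3_unit[OF p] by (simp add: D_vertical[OF p])
  then show "g p (D T U p) (e3 p) = k p"
    using pullback_derivative_symmetric[OF p T U e3] by simp
qed

text \<open>
  The derivative of a null field has no product with that field, which leaves one coefficient of each
  projection. Pairing \<open>D_vertical\<close> with \<open>U\<close> yields those of \<open>D\<^sub>T T\<close> and \<open>D\<^sub>U T\<close>, and
  \<open>D_skew\<close> transfers them to \<open>D\<^sub>T U\<close> and \<open>D\<^sub>U U\<close>.
\<close>

lemma surface_connection:
  assumes p: "p \<in> pts M"
  defines "\<mu> \<equiv> g p (D U U p) (e3 p)"
  shows "surface_nabla c f M T T p = 0"
    "surface_nabla c f M T U p = 0"
    "surface_nabla c f M U T p = (k p - \<mu>) *\<^sub>R T p"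
    "surface_nabla c f M U U p = - (k p - \<mu>) *\<^sub>R U p"
proof -
  have null_component: "g p (D X Y p) (Y p) = 0" if "X \<in> {T, U}" "Y \<in> {T, U}" for X Y
    using D_skew[OF p that(1), of Y Y] that(2) by auto
  have "g p (D T e3 p) (U p) = - k p" "g p (D U e3 p) (U p) = - \<mu>"
    using D_skew[OF p, of T e3 U] D_skew[OF p, of U e3 U] e3_components(2)[OF p]
    by (simp_all add: \<mu>_def)
  then have TT: "g p (D T T p) (U p) = 0" and UT: "g p (D U T p) (U p) = \<mu> - k p"
    using null[OF p] normal_tangent[OF p] by (simp_all add: D_vertical[OF p])
  have "g p (D T U p) (T p) = 0" "g p (D U U p) (T p) = k p - \<mu>"
    using D_skew[OF p, of T U T] D_skew[OF p, of U U T] TT UT by simp_all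
  then show "surface_nabla c f M T T p = 0" "surface_nabla c f M T U p = 0"
    "surface_nabla c f M U T p = (k p - \<mu>) *\<^sub>R T p"
    "surface_nabla c f M U U p = - (k p - \<mu>) *\<^sub>R U p"
    using TT UT null_component by (simp_all add: surface_nabla_frame p proj_def flip: scaleR_minus_left)
qed

end



theorem lemma3p9:
  fixes c s :: real
    and I :: "real set"
    and f :: "real \<Rightarrow> real"
    and M :: "'m surface"
    and T U e3 e4 :: "'m \<Rightarrow> ambient"
    and h :: "nat \<Rightarrow> nat \<Rightarrow> nat \<Rightarrow> 'm \<Rightarrow> real"
  defines "II \<equiv> second_fundamental_form c I f M"
    and "A \<equiv> shape_operator c I f M"
    and "g \<equiv> induced_metric c f M"
    and "k \<equiv> \<lambda>p. deriv f (snd (imm M p)) / f (snd (imm M p))"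
  assumes c: "c \<in> {-1, 0, 1}"
    and I: "open I" "is_interval I" "I \<noteq> {}"
    and f: "smooth_on I f" "\<forall>z\<in>I. f z > 0"
    and M: "smooth_2_manifold M" "oriented_charts M" "immersed_in_warped c I M" "time_like c f M"
    and not_tot_geod: "\<not> (\<exists>W P. openin (topo M) W \<and> W \<noteq> {} \<and>
          totally_geodesic_hypersurface c I f P \<and> imm M ` W \<subseteq> P)"
    and T: "tangent_field M (pts M) T"
    and e3: "normal_field c f M e3"
    and decomposition: "\<forall>p\<in>pts M. d_dz = T p + e3 p"
    and nowhere_zero: "\<forall>p\<in>pts M. T p \<noteq> 0 \<and> e3 p \<noteq> 0"
    and light_like: "\<forall>p\<in>pts M. g p (T p) (T p) = 0"
    and U: "tangent_field M (pts M) U" "\<forall>p\<in>pts M. g p (U p) (U p) = 0 \<and> g p (T p) (U p) = -1"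
    and e4: "normal_field c f M e4" "\<forall>p\<in>pts M. g p (e4 p) (e4 p) = 1 \<and> g p (e3 p) (e4 p) = 0"
    and orientation: "s \<in> {-1, 1}"
      "\<forall>p\<in>pts M. positive_frame c s (imm M p) (T p) (U p) (e3 p) (e4 p)"
    and h_smooth: "\<forall>a\<in>{3,4}. \<forall>(i,j)\<in>{(1,1),(1,2),(2,2)}. surface_smooth_on M (pts M) (h a i j)"
    and h: "\<forall>p\<in>pts M. II T T p = h 3 1 1 p *\<^sub>R e3 p + h 4 1 1 p *\<^sub>R e4 p"
      "\<forall>p\<in>pts M. II T U p = h 3 1 2 p *\<^sub>R e3 p + h 4 1 2 p *\<^sub>R e4 p"
      "\<forall>p\<in>pts M. II U U p = h 3 2 2 p *\<^sub>R e3 p + h 4 2 2 p *\<^sub>R e4 p"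
  shows "\<forall>p\<in>pts M.
    (surface_nabla c f M T T p = 0 \<and>
     surface_nabla c f M T U p = 0 \<and>
     surface_nabla c f M U T p = (k p - h 3 2 2 p) *\<^sub>R T p \<and>
     surface_nabla c f M U U p = - (k p - h 3 2 2 p) *\<^sub>R U p) \<and>
    (has_matrix (T p) (U p) (A e3 T p) (A e3 U p)
       (vector [vector [- k p, - h 3 2 2 p], vector [0, - k p]]) \<and>
     has_matrix (T p) (U p) (A e4 T p) (A e4 U p)
       (vector [vector [- h 4 1 2 p, - h 4 2 2 p], vector [- h 4 1 1 p, - h 4 1 2 p]])) \<and>
    (II T T p = h 4 1 1 p *\<^sub>R e4 p \<and>
     II T U p = k p *\<^sub>R e3 p + h 4 1 2 p *\<^sub>R e4 p \<and>
     II U U p = h 3 2 2 p *\<^sub>R e3 p + h 4 2 2 p *\<^sub>R e4 p) \<and>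
    (normal_nabla c I f M T e3 p = - h 4 1 1 p *\<^sub>R e4 p \<and>
     normal_nabla c I f M U e3 p = - h 4 1 2 p *\<^sub>R e4 p)"
proof
  fix p assume p: "p \<in> pts M"
  interpret adapted_frame c I f M T U e3 e4 s
    by unfold_locales (use assms in \<open>auto simp: g_def\<close>)
  note frame_II = second_fundamental_form_frame[OF p, folded II_def]
  have II: "D T T p - proj p (D T T p) = h 3 1 1 p *\<^sub>R e3 p + h 4 1 1 p *\<^sub>R e4 p"
    "D T U p - proj p (D T U p) = h 3 1 2 p *\<^sub>R e3 p + h 4 1 2 p *\<^sub>R e4 p"
    "D U U p - proj p (D U U p) = h 3 2 2 p *\<^sub>R e3 p + h 4 2 2 p *\<^sub>R e4 p"
    using h p frame_II[of T T] frame_II[of T U] frame_II[of U U] by simp_all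
  note TT = normal_coordinates[OF p II(1), folded g_def]
    and TU = normal_coordinates[OF p II(2), folded g_def]
    and UU = normal_coordinates[OF p II(3), folded g_def]
  have UT: "g p (D U T p) (e3 p) = h 3 1 2 p" "g p (D U T p) (e4 p) = h 4 1 2 p"
    using pullback_derivative_symmetric[OF p T U(1) e3]
      pullback_derivative_symmetric[OF p T U(1) e4(1)] TU by (simp_all add: g_def)
  have h3: "h 3 1 1 p = 0" "h 3 1 2 p = k p"
    using e3_components[OF p] TT TU by (simp_all add: g_def k_def)
  have "surface_nabla c f M T T p = 0" "surface_nabla c f M T U p = 0"
    "surface_nabla c f M U T p = (k p - h 3 2 2 p) *\<^sub>R T p"
    "surface_nabla c f M U U p = - (k p - h 3 2 2 p) *\<^sub>R U p"
    using surface_connection[OF p] UU by (simp_all add: g_def k_def)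
  moreover have "has_matrix (T p) (U p) (A e3 T p) (A e3 U p)
      (vector [vector [- k p, - h 3 2 2 p], vector [0, - k p]])"
    "has_matrix (T p) (U p) (A e4 T p) (A e4 U p)
      (vector [vector [- h 4 1 2 p, - h 4 2 2 p], vector [- h 4 1 1 p, - h 4 1 2 p]])"
    using TT TU UT UU h3
    by (simp_all add: has_matrix_def A_def shape_operator_frame p g_def)
  moreover have "II T T p = h 4 1 1 p *\<^sub>R e4 p" "II T U p = k p *\<^sub>R e3 p + h 4 1 2 p *\<^sub>R e4 p"
    "II U U p = h 3 2 2 p *\<^sub>R e3 p + h 4 2 2 p *\<^sub>R e4 p"
    using h p h3 by simp_all
  moreover from this have "normal_nabla c I f M T e3 p = - h 4 1 1 p *\<^sub>R e4 p"
    "normal_nabla c I f M U e3 p = - h 4 1 2 p *\<^sub>R e4 p"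
    using normal_nabla_e3[OF p] by (simp_all add: II_def k_def)
  ultimately show "(surface_nabla c f M T T p = 0 \<and>
     surface_nabla c f M T U p = 0 \<and>
     surface_nabla c f M U T p = (k p - h 3 2 2 p) *\<^sub>R T p \<and>
     surface_nabla c f M U U p = - (k p - h 3 2 2 p) *\<^sub>R U p) \<and>
    (has_matrix (T p) (U p) (A e3 T p) (A e3 U p)
       (vector [vector [- k p, - h 3 2 2 p], vector [0, - k p]]) \<and>
     has_matrix (T p) (U p) (A e4 T p) (A e4 U p)
       (vector [vector [- h 4 1 2 p, - h 4 2 2 p], vector [- h 4 1 1 p, - h 4 1 2 p]])) \<and>
    (II T T p = h 4 1 1 p *\<^sub>R e4 p \<and>
     II T U p = k p *\<^sub>R e3 p + h 4 1 2 p *\<^sub>R e4 p \<and>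
     II U U p = h 3 2 2 p *\<^sub>R e3 p + h 4 2 2 p *\<^sub>R e4 p) \<and>
    (normal_nabla c I f M T e3 p = - h 4 1 1 p *\<^sub>R e4 p \<and>
     normal_nabla c I f M U e3 p = - h 4 1 2 p *\<^sub>R e4 p)" by blast
qed

end
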